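(* Consider the equation with constant delay $\tau=a/v^+$ (i.e. $v^-=v^+$), so that it reads $x'(t)=\beta e^{-\mu\tau}g(x(t-\tau))-\gamma x(t)$, and assume $g$ is monotonically decreasing, i.e. $g^->g^+$. Let $\xi$ be its (unique) steady state. Then: (1) If $\big|\xi g'(\xi)/g(\xi)\big|<1$, then $\xi$ is asymptotically stable. (2) If $n\le1$, or $n>1$ and $r_g=g^-/g^+<\big(1+\frac{2}{n-1}\big)^2$, then $\xi$ is asymptotically stable. (3) For any fixed $n>1$, the steady state is asymptotically stable whenever $\xi>0$ is sufficiently small or sufficiently large, equivalently whenever $\gamma$ is sufficiently large or $\gamma>0$ is sufficiently small. (4) For any fixed $\xi\ne\theta_g$ let $\gamma=\gamma(n,\xi)$ be the value of $\gamma$ for which $\xi$ is a steady state; or, for any fixed $\gamma$ with $0<\gamma<\gamma_1$ or $\gamma>\gamma_2$, let $\xi=\xi(n,\gamma)$ be the steady state. Then $\xi$ is asymptotically stable for all $n$ sufficiently large. (5) Let $n\ge2$ and an integer $k\ge0$ be fixed and satisfy $$n>2\frac{(g^-/g^+)+1}{(g^-/g^+)-1}\Big(1+\Big(\frac{\pi\theta_g(2k+1)}{\beta\tau e^{-\mu\tau}g_0}\Big)^2\Big)^{1/2}.$$ Then as $\gamma$ is varied: (a) there are two families of (at least) $k+1$ Hopf bifurcations, one existing for $\gamma<\sqrt{\gamma_1\gamma_2}/(g^-/g^+)^{1/(2n)}$ and the other for $\gamma>(\gamma_1+\gamma_2)/2$; in the first family the characteristic values $\lambda_j=i\omega_j$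 with $\omega_j\tau\in(\pi/2+2j\pi,\pi+2j\pi)$, $j=0,1,\dots,k$, cross the imaginary axis from left to right as $\gamma$ increases, while in the second family they cross from right to left; (b) for $\xi\in[\theta_g,\theta_g(g^-/g^+)^{1/(2n)}]$, or equivalently for $\gamma\in[\sqrt{\gamma_1\gamma_2}/(g^-/g^+)^{1/(2n)},(\gamma_1+\gamma_2)/2]$, the steady state is unstable with at least $k+1$ pairs of complex conjugate characteristic values $\lambda_j=\alpha_j\pm i\omega_j$ with $\alpha_j>0$ and $\omega_j\tau\in(\pi/2+2j\pi,\pi+2j\pi)$, $j=0,1,\dots,k$. (6) Let $\gamma\in(\gamma_1,\gamma_2)$ be fixed. Then as $n$ is increased there is an infinite sequence of Hopf bifurcations at which the real part of $\lambda_k=\alpha_k\pm i\omega_k$ becomes positive, with $\omega_k\tau\in(\pi/2+2k\pi,\pi+2k\pi)$, $k=0,1,2,\dots$.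
   Context: The model is the scalar delay differential equation $x'(t)=\beta e^{-\mu\tau(t)}\frac{v(x(t))}{v(x(t-\tau(t)))}g(x(t-\tau(t)))-\gamma x(t)$ with the delay defined by $a=\int_{t-\tau(t)}^t v(x(s))\,ds$, constants $\beta,\mu,\gamma,a>0$, and Hill functions $g(x)=\frac{g^-\theta_g^n+g^+x^n}{\theta_g^n+x^n}$, $v(x)=\frac{v^-\theta_v^m+v^+x^m}{\theta_v^m+x^m}$ with all parameters positive. Here $v^-=v^+$, so $\tau=a/v^+$ is constant. A steady state is a constant solution $x\equiv\xi>0$, i.e. $\beta e^{-\mu\tau}g(\xi)=\gamma\xi$; for $g$ decreasing it is unique, and for each $\xi>0$ the unique $\gamma$ making $\xi$ a steady state is $\gamma(\xi)=\beta e^{-\mu\tau}g(\xi)/\xi$, a decreasing function of $\xi$. Characteristic values are the roots $\lambda\in\mathbb{C}$ of $\lambda=-\gamma+\beta e^{-\mu\tau}g'(\xi)e^{-\lambda\tau}$; the steady state is asymptotically stable if all have negative real part and unstable if one has positive real part. A Hopf bifurcation is a parameter value at which a pair of characteristic values $\pm i\omega$, $\omega>0$, lies on (crosses) the imaginary axis. Notation: $g_0=\min\{g^-,g^+\}$, $\gamma_1=\beta e^{-\mu\tau}g^+/\theta_g$, $\gamma_2=\beta e^{-\mu\tau}g^-/\theta_g$. *)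

theory Defs
  imports "HOL-Analysis.Analysis"
begin

definition hill :: "real \<Rightarrow> real \<Rightarrow> real \<Rightarrow> real \<Rightarrow> real \<Rightarrow> real" where
  "hill lo hi th n x = (lo * th powr n + hi * x powr n) / (th powr n + x powr n)"

text \<open>Steady state of  x'(t) = beta e^(-mu tau) g(x(t-tau)) - gamma x(t),  g = hill gm gp th n.\<close>
definition steady :: "real \<Rightarrow> real \<Rightarrow> real \<Rightarrow> real \<Rightarrow> real \<Rightarrow> real \<Rightarrow> real \<Rightarrow> real \<Rightarrow> real \<Rightarrow> bool" where
  "steady beta mu tau gm gp th n gam xi \<longleftrightarrow>
     xi > 0 \<and> beta * exp (- mu * tau) * hill gm gp th n xi = gam * xi"

definition char_root :: "real \<Rightarrow> real \<Rightarrow> real \<Rightarrow> real \<Rightarrow> real \<Rightarrow> real \<Rightarrow> real \<Rightarrow> real \<Rightarrow> real \<Rightarrow> complex \<Rightarrow> bool" where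
  "char_root beta mu tau gm gp th n gam xi lam \<longleftrightarrow>
     lam = - complex_of_real gam
           + complex_of_real (beta * exp (- mu * tau) * deriv (hill gm gp th n) xi) * exp (- lam * complex_of_real tau)"

definition asym_stable :: "real \<Rightarrow> real \<Rightarrow> real \<Rightarrow> real \<Rightarrow> real \<Rightarrow> real \<Rightarrow> real \<Rightarrow> real \<Rightarrow> real \<Rightarrow> bool" where
  "asym_stable beta mu tau gm gp th n gam xi \<longleftrightarrow>
     (\<forall>lam. char_root beta mu tau gm gp th n gam xi lam \<longrightarrow> Re lam < 0)"

definition unstable :: "real \<Rightarrow> real \<Rightarrow> real \<Rightarrow> real \<Rightarrow> real \<Rightarrow> real \<Rightarrow> real \<Rightarrow> real \<Rightarrow> real \<Rightarrow> bool" where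
  "unstable beta mu tau gm gp th n gam xi \<longleftrightarrow>
     (\<exists>lam. char_root beta mu tau gm gp th n gam xi lam \<and> Re lam > 0)"

definition char_root_at :: "real \<Rightarrow> real \<Rightarrow> real \<Rightarrow> real \<Rightarrow> real \<Rightarrow> real \<Rightarrow> real \<Rightarrow> real \<Rightarrow> complex \<Rightarrow> bool" where
  "char_root_at beta mu tau gm gp th n gam lam \<longleftrightarrow>
     (\<exists>xi. steady beta mu tau gm gp th n gam xi \<and> char_root beta mu tau gm gp th n gam xi lam)"

definition hopf_LR :: "(real \<Rightarrow> complex \<Rightarrow> bool) \<Rightarrow> real \<Rightarrow> real \<Rightarrow> bool" where
  "hopf_LR P s0 om \<longleftrightarrow> om > 0 \<and> P s0 (\<i> * of_real om) \<and> P s0 (- \<i> * of_real om) \<and>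
     (\<exists>d>0. \<exists>l :: real \<Rightarrow> complex. l s0 = \<i> * of_real om \<and> isCont l s0 \<and>
        (\<forall>s. \<bar>s - s0\<bar> < d \<longrightarrow> P s (l s)) \<and>
        (\<forall>s. s0 - d < s \<and> s < s0 \<longrightarrow> Re (l s) < 0) \<and>
        (\<forall>s. s0 < s \<and> s < s0 + d \<longrightarrow> Re (l s) > 0))"

definition hopf_RL :: "(real \<Rightarrow> complex \<Rightarrow> bool) \<Rightarrow> real \<Rightarrow> real \<Rightarrow> bool" where
  "hopf_RL P s0 om \<longleftrightarrow> om > 0 \<and> P s0 (\<i> * of_real om) \<and> P s0 (- \<i> * of_real om) \<and>
     (\<exists>d>0. \<exists>l :: real \<Rightarrow> complex. l s0 = \<i> * of_real om \<and> isCont l s0 \<and>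
        (\<forall>s. \<bar>s - s0\<bar> < d \<longrightarrow> P s (l s)) \<and>
        (\<forall>s. s0 - d < s \<and> s < s0 \<longrightarrow> Re (l s) > 0) \<and>
        (\<forall>s. s0 < s \<and> s < s0 + d \<longrightarrow> Re (l s) < 0))"

end

theory Submission
  imports Defs
begin

text \<open>
  Put \<open>u = n ln (\<xi>/\<theta>)\<close>, \<open>r = g\<^sup>-/g\<^sup>+\<close>, \<open>p = \<gamma>\<tau>\<close> and \<open>h = -\<xi>g'(\<xi>)/g(\<xi>)\<close>, so that \<open>z = \<lambda>\<tau>\<close> is
  characteristic iff \<open>z = -p - p h e\<^bsup>-z\<^esup>\<close>. If \<open>h < 1\<close>, taking norms forces \<open>Re z < 0\<close>; this gives the
  stability claims.

  Splitting into real and imaginary parts, the roots with \<open>Im z = w\<close> in \<open>(\<pi>/2 + 2j\<pi>, \<pi> + 2j\<pi>)\<close> are given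
  by \<open>Re z = -w cot w - p\<close> and \<open>(w / sin w) exp (-w cot w) = h p e\<^sup>p\<close>. The left side is strictly increasing
  in \<open>w\<close>, so each \<open>j\<close> yields one explicit continuous branch of roots, and \<open>Re z\<close> has the sign of
  \<open>p \<surd>(h\<^sup>2 - 1) - arccos (-1/h) - 2j\<pi>\<close>. A Hopf bifurcation is thus a simple zero of a real function of
  one parameter: existence is the intermediate value theorem and the direction of crossing is the
  sign of a derivative.

  For \<open>\<xi>\<close> above the maximum of \<open>h\<close>, \<open>p\<close> and \<open>h\<close> both increase with \<open>\<gamma>\<close> and the sign is clear. For
  \<open>\<xi> < \<theta>\<close> they move in opposite directions; a degenerate zero would need \<open>\<xi>\<close> so close to \<open>\<theta>\<close> that the
  hypothesis on \<open>n\<close> still makes the function positive there. For fixed \<open>\<gamma>\<close>, \<open>p\<close> is constant and \<open>h\<close> is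
  strictly increasing in \<open>n\<close>.
\<close>

section \<open>Branches of characteristic roots\<close>

definition branch :: "nat \<Rightarrow> real set" where
  "branch j = {pi / 2 + 2 * real j * pi <..< pi + 2 * real j * pi}"

definition growth :: "real \<Rightarrow> real" where
  "growth w = w / sin w * (- cos w)"

definition modulus :: "real \<Rightarrow> real" where
  "modulus w = w / sin w * exp (growth w)"

text \<open>The truncation \<open>max 1 h\<close> makes the function continuous in \<open>h\<close> on the whole line and negative
  for \<open>h \<le> 1\<close>.\<close>
definition gap :: "nat \<Rightarrow> real \<Rightarrow> real \<Rightarrow> real" where
  "gap j p h = p * sqrt ((max 1 h)\<^sup>2 - 1) - arccos (- 1 / max 1 h) - 2 * real j * pi"

lemma sin_shift: "sin (x + 2 * real j * pi) = sin x"
  and cos_shift: "cos (x + 2 * real j * pi) = cos x"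
  by (simp_all add: sin_add cos_add)

lemma branch_sin_pos:
  assumes "pi / 2 + 2 * real j * pi \<le> w" "w < pi + 2 * real j * pi"
  shows "sin w > 0"
  using sin_shift[of "w - 2 * real j * pi" j] sin_gt_zero[of "w - 2 * real j * pi"] assms pi_gt_zero
  by (auto simp: algebra_simps)

lemma branch_trig:
  assumes "w \<in> branch j"
  shows "sin w > 0" "cos w < 0" "w > 1" "growth w > 0"
proof -
  show s: "sin w > 0" using branch_sin_pos[of j w] assms by (auto simp: branch_def)
  have "cos (w - 2 * real j * pi) < cos (pi / 2)"
    by (rule cos_monotone_0_pi) (use assms in \<open>auto simp: branch_def algebra_simps\<close>)
  then show c: "cos w < 0" using cos_shift[of "w - 2 * real j * pi" j] by simp
  have "0 \<le> 2 * real j * pi" by simp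
  then show w: "w > 1" using assms pi_half_gt_zero pi_gt3 unfolding branch_def greaterThanLessThan_iff by linarith
  show "growth w > 0" unfolding growth_def using s c w by (intro mult_pos_pos divide_pos_pos) auto
qed

lemma branch_cos_less:
  assumes "w \<in> branch j" "v \<in> branch j" "w < v"
  shows "cos v < cos w"
proof -
  have "cos (v - 2 * real j * pi) < cos (w - 2 * real j * pi)"
    by (rule cos_monotone_0_pi) (use assms pi_gt_zero in \<open>auto simp: branch_def algebra_simps\<close>)
  then show ?thesis
    using cos_shift[of "v - 2 * real j * pi" j] cos_shift[of "w - 2 * real j * pi" j] by simp
qed

lemma branch_sin_less:
  assumes "w \<in> branch j" "v \<in> branch j" "w < v"
  shows "sin v < sin w"
proof -
  have "(cos w)\<^sup>2 < (cos v)\<^sup>2"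
    using branch_cos_less[OF assms] branch_trig(2)[OF assms(1)] branch_trig(2)[OF assms(2)]
    by (metis abs_le_square_iff abs_of_neg linorder_not_less neg_le_iff_le)
  then have "(sin v)\<^sup>2 < (sin w)\<^sup>2" by (simp add: sin_squared_eq)
  then show ?thesis using branch_trig(1)[OF assms(1)] by (simp add: power2_less_imp_less)
qed

lemma modulus_strict_mono: "strict_mono_on (branch j) modulus"
proof (rule strict_mono_onI)
  fix w v assume wv: "w \<in> branch j" "v \<in> branch j" "w < v"
  note t = branch_trig[OF wv(1)] branch_trig[OF wv(2)]
  have q: "w / sin w < v / sin v"
    using t wv branch_sin_less[OF wv] by (intro frac_less) auto
  have "growth w < growth v"
    unfolding growth_def using q t branch_cos_less[OF wv] by (intro mult_strict_mono) auto
  then show "modulus w < modulus v"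
    unfolding modulus_def using q t by (intro mult_strict_mono) auto
qed

lemma modulus_less_iff:
  assumes "w \<in> branch j" "v \<in> branch j"
  shows "modulus w < modulus v \<longleftrightarrow> w < v"
  using strict_mono_on_less[OF modulus_strict_mono] assms by blast

lemma modulus_gt:
  assumes "w \<in> branch j"
  shows "modulus w > w"
proof -
  note t = branch_trig[OF assms]
  have "sin w \<le> 1" by simp
  then have "w \<le> w / sin w" using t by (simp add: field_simps)
  moreover have "w / sin w * 1 < w / sin w * exp (growth w)"
    using t by (intro mult_strict_left_mono) auto
  ultimately show ?thesis unfolding modulus_def by linarith
qed

lemma isCont_modulus: "sin w \<noteq> 0 \<Longrightarrow> isCont modulus w"
  unfolding modulus_def growth_def by (intro continuous_intros) auto

lemma modulus_surj:
  assumes Q: "Q > pi / 2 + 2 * real j * pi"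
  shows "\<exists>w\<in>branch j. modulus w = Q"
proof -
  let ?a = "pi / 2 + 2 * real j * pi"
  have j0: "0 \<le> 2 * real j * pi" by simp
  have a0: "?a > 1" using j0 pi_gt3 by linarith
  define e where "e = 1 / Q"
  have e: "0 < e" "e < 1" using Q a0 by (auto simp: e_def)
  define b where "b = pi - arcsin e + 2 * real j * pi"
  have as: "0 < arcsin e" "arcsin e < pi / 2"
    using e arcsin_less_mono[of 0 e] arcsin_less_mono[of e 1] by auto
  have b: "b \<in> branch j" using as by (auto simp: branch_def b_def)
  have "sin b = e" unfolding b_def sin_shift using e by simp
  then have "Q * b \<le> modulus b"
    using branch_trig[OF b] e Q a0 unfolding modulus_def e_def by (simp add: mult_ac)
  moreover have "Q * 1 < Q * b" using branch_trig(3)[OF b] Q a0 by (intro mult_strict_left_mono) auto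
  ultimately have up: "Q < modulus b" by simp
  have "sin ?a = 1" "cos ?a = 0" using sin_shift[of "pi/2" j] cos_shift[of "pi/2" j] by simp_all
  then have low: "modulus ?a = ?a" by (simp add: modulus_def growth_def)
  have ab: "?a \<le> b" using b by (auto simp: branch_def)
  have bb: "b < pi + 2 * real j * pi" using b by (auto simp: branch_def)
  have "\<exists>x\<ge>?a. x \<le> b \<and> modulus x = Q"
    by (rule IVT) (use low up Q ab bb branch_sin_pos[of j] in \<open>auto intro!: isCont_modulus dest: less_imp_neq\<close>, force)
  then obtain x where x: "?a \<le> x" "x \<le> b" "modulus x = Q" by blast
  have "x \<noteq> ?a" using x low Q by auto
  then have "x \<in> branch j" using x bb by (auto simp: branch_def)
  then show ?thesis using x by blast
qed

lemma branch_root: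
  assumes w: "w \<in> branch j" and Q: "modulus w = h * p * exp p"
  shows "Complex (growth w - p) w = - of_real p - of_real (p * h) * exp (- Complex (growth w - p) w)"
proof -
  have "p * h * exp (p - growth w) = w / sin w"
    using Q unfolding modulus_def by (simp add: exp_diff field_simps)
  then show ?thesis using branch_trig(1)[OF w]
    by (auto simp: complex_eq_iff Re_exp Im_exp growth_def mult.assoc[symmetric] simp del: mult.assoc)
qed

lemma arccos_branch:
  fixes h :: real and j :: nat
  assumes "h > 1"
  defines "W \<equiv> arccos (- 1 / h) + 2 * real j * pi"
  shows "W \<in> branch j" "cos W = - 1 / h" "growth W = W / sqrt (h\<^sup>2 - 1)"
    "modulus W = h * growth W * exp (growth W)"
proof -
  have h: "-1 < -1 / h" "-1 / h < 0" using assms by (auto simp: field_simps)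
  have "arccos 0 < arccos (-1 / h)" "arccos (-1 / h) < arccos (-1)"
    using h by (intro arccos_less_arccos; linarith)+
  then show W: "W \<in> branch j" by (auto simp: branch_def W_def)
  show c: "cos W = - 1 / h" unfolding W_def cos_shift using h by (intro cos_arccos) linarith+
  have "(sin W)\<^sup>2 = (h\<^sup>2 - 1) / h\<^sup>2" unfolding sin_squared_eq c using assms(1) by (simp add: field_simps)
  then have s: "sin W = sqrt (h\<^sup>2 - 1) / h"
    using branch_trig(1)[OF W] assms(1) by (metis abs_of_pos less_trans real_sqrt_abs real_sqrt_divide zero_less_one)
  show g: "growth W = W / sqrt (h\<^sup>2 - 1)" unfolding growth_def s c using assms(1) by simp
  show "modulus W = h * growth W * exp (growth W)"
    unfolding modulus_def g unfolding s by simp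
qed

lemma gap_pos_D: "gap j p h \<ge> 0 \<Longrightarrow> h > 1"
proof (rule ccontr)
  assume g: "gap j p h \<ge> 0" and "\<not> h > 1"
  then have "max 1 h = 1" by simp
  then have "gap j p h = - pi - 2 * real j * pi" unfolding gap_def by simp
  moreover have "0 \<le> 2 * real j * pi" by simp
  ultimately show False using g pi_gt_zero by linarith
qed

lemma gap_pos_if:
  assumes h: "h > 1" and p: "p > 0" and b: "((2 * real j + 1) * pi)\<^sup>2 \<le> p\<^sup>2 * (h\<^sup>2 - 1)"
  shows "gap j p h > 0"
proof -
  have "((2 * real j + 1) * pi)\<^sup>2 \<le> (p * sqrt (h\<^sup>2 - 1))\<^sup>2" using b h by (simp add: power_mult_distrib)
  then have "(2 * real j + 1) * pi \<le> p * sqrt (h\<^sup>2 - 1)"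
    by (rule power2_le_imp_le) (use p h in simp)
  moreover have "arccos (- 1 / h) + 2 * real j * pi < pi + 2 * real j * pi"
    using arccos_branch(1)[OF h, of j] by (simp add: branch_def)
  ultimately show ?thesis using h by (simp add: gap_def max_def algebra_simps)
qed

lemma gap_zero_imp:
  assumes p: "p > 0" and g: "gap j p h = 0"
  shows "p\<^sup>2 * (h\<^sup>2 - 1) < ((2 * real j + 1) * pi)\<^sup>2"
  using gap_pos_if[OF _ p, of h j] gap_pos_D[of j p h] g by force

lemma x_exp_less_iff:
  fixes x y :: real
  assumes "x > 0" "y > 0"
  shows "x * exp x < y * exp y \<longleftrightarrow> x < y"
proof -
  have *: "a * exp a < b * exp b" if "a < b" "a > 0" for a b :: real
    using that by (intro mult_strict_mono) auto
  show ?thesis using *[of x y] *[of y x] assms by (cases x y rule: linorder_cases) auto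
qed

lemma branch_sign:
  assumes p: "p > 0" and h: "h > 1" and w: "w \<in> branch j" and Q: "modulus w = h * p * exp p"
  shows "sgn (growth w - p) = sgn (gap j p h)"
proof -
  define W where "W = arccos (- 1 / h) + 2 * real j * pi"
  note W = arccos_branch[OF h, of j, folded W_def]
  note t = branch_trig[OF w] and T = branch_trig[OF W(1)]
  have s: "sqrt (h\<^sup>2 - 1) > 0" using h by simp
  have gap: "gap j p h = (p - growth W) * sqrt (h\<^sup>2 - 1)"
    using h s less_imp_neq[OF s] W(3) by (simp add: gap_def W_def max_def left_diff_distrib)
  have m: "modulus w = growth w * exp (growth w) / (- cos w)"
    using t by (simp add: modulus_def growth_def)
  have eq: "p * exp p * (h * (- cos w)) = growth w * exp (growth w)"
    using Q t unfolding m by (simp add: field_simps)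
  have iff1: "growth W < p \<longleftrightarrow> W < w"
    using x_exp_less_iff[OF T(4) p] h Q W(4) modulus_less_iff[OF W(1) w]
    by (metis mult.assoc mult_less_cancel_left_pos zero_less_one less_trans)
  have iff2: "p < growth W \<longleftrightarrow> w < W"
    using x_exp_less_iff[OF p T(4)] h Q W(4) modulus_less_iff[OF w W(1)]
    by (metis mult.assoc mult_less_cancel_left_pos zero_less_one less_trans)
  have pe: "0 < p * exp p" using p by simp
  consider "W < w" | "w < W" | "w = W" by linarith
  then show ?thesis
  proof cases
    case 1
    then have "h * (- cos w) > 1" using branch_cos_less[OF W(1) w] W(2) h by (simp add: field_simps)
    then have "p * exp p * 1 < p * exp p * (h * (- cos w))" using pe by (intro mult_strict_left_mono)
    then have "p < growth w" using x_exp_less_iff[OF p t(4)] eq by simp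
    then show ?thesis using 1 iff1 gap s by (simp add: sgn_mult)
  next
    case 2
    then have "h * (- cos w) < 1" using branch_cos_less[OF w W(1)] W(2) h by (simp add: field_simps)
    then have "p * exp p * (h * (- cos w)) < p * exp p * 1" using pe by (intro mult_strict_left_mono)
    then have "growth w < p" using x_exp_less_iff[OF t(4) p] eq by simp
    then show ?thesis using 2 iff2 gap s by (simp add: sgn_mult)
  next
    case 3
    then have "growth w = p" using iff1 iff2 by auto
    then show ?thesis using 3 gap by simp
  qed
qed

lemma gap_pos_root:
  assumes p: "p > 0" and g: "gap j p h > 0"
  shows "\<exists>w\<in>branch j. growth w > p \<and> modulus w = h * p * exp p"
proof -
  have h: "h > 1" using gap_pos_D[of j p h] g by simp
  define W where "W = arccos (- 1 / h) + 2 * real j * pi"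
  note W = arccos_branch[OF h, of j, folded W_def]
  have s: "sqrt (h\<^sup>2 - 1) > 0" using h by simp
  have "gap j p h = (p - growth W) * sqrt (h\<^sup>2 - 1)"
    using h s less_imp_neq[OF s] W(3) by (simp add: gap_def W_def max_def left_diff_distrib)
  then have "growth W < p" using g s by (simp add: zero_less_mult_iff)
  then have "modulus W < h * p * exp p"
    using x_exp_less_iff[OF branch_trig(4)[OF W(1)] p] h W(4) by (simp add: mult.assoc)
  then have "h * p * exp p > pi / 2 + 2 * real j * pi"
    using modulus_gt[OF W(1)] W(1) by (auto simp: branch_def)
  then obtain w where w: "w \<in> branch j" "modulus w = h * p * exp p" using modulus_surj by blast
  then have "sgn (growth w - p) = 1" using branch_sign[OF p h] g by simp
  then show ?thesis using w by (auto simp: sgn_1_pos)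
qed

lemma isCont_branch_inverse:
  assumes w: "w \<in> branch j"
  shows "isCont (inv_into (branch j) modulus) (modulus w)"
proof -
  have inj: "inj_on modulus (branch j)" using modulus_strict_mono by (rule strict_mono_on_imp_inj_on)
  define a b where "a = (w + (pi / 2 + 2 * real j * pi)) / 2" and "b = (w + (pi + 2 * real j * pi)) / 2"
  have ab: "a < w" "w < b" and sub: "{a..b} \<subseteq> branch j"
    using w by (auto simp: a_def b_def branch_def field_simps)
  show ?thesis
  proof (rule isCont_inverse_function2[OF ab])
    show "\<And>z. a \<le> z \<Longrightarrow> z \<le> b \<Longrightarrow> inv_into (branch j) modulus (modulus z) = z"
      using sub inj by (auto intro!: inv_into_f_f)
    show "\<And>z. a \<le> z \<Longrightarrow> z \<le> b \<Longrightarrow> isCont modulus z"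
      using sub branch_trig(1)[of _ j] by (force intro!: isCont_modulus)
  qed
qed

lemma crossing_branch:
  fixes p h :: "real \<Rightarrow> real"
  assumes tau: "tau > 0" and cp: "isCont p s0" and ch: "isCont h s0"
    and p0: "p s0 > 0" and gap0: "gap j (p s0) (h s0) = 0"
  shows "\<exists>om d l. om * tau \<in> branch j \<and> d > 0 \<and> l s0 = \<i> * of_real om \<and> isCont l s0 \<and>
    (\<forall>s. \<bar>s - s0\<bar> < d \<longrightarrow>
       l s * of_real tau = - of_real (p s) - of_real (p s * h s) * exp (- l s * of_real tau) \<and>
       sgn (Re (l s)) = sgn (gap j (p s) (h s)))"
proof -
  define Q where "Q s = h s * p s * exp (p s)" for s
  define w where "w s = inv_into (branch j) modulus (Q s)" for s
  define l where "l s = Complex ((growth (w s) - p s) / tau) (w s / tau)" for s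
  have h0: "h s0 > 1" using gap_pos_D[of j "p s0" "h s0"] gap0 by simp
  define W where "W = arccos (- 1 / h s0) + 2 * real j * pi"
  note W = arccos_branch[OF h0, of j, folded W_def]
  have inj: "inj_on modulus (branch j)" using modulus_strict_mono by (rule strict_mono_on_imp_inj_on)
  have s: "sqrt ((h s0)\<^sup>2 - 1) > 0" using h0 by simp
  have gW: "growth W = p s0"
    using gap0 h0 s less_imp_neq[OF s] unfolding W(3) by (simp add: gap_def W_def max_def divide_eq_eq)
  have QW: "Q s0 = modulus W" unfolding W(4) gW Q_def by simp
  have wW: "w s0 = W" unfolding w_def QW using inj W(1) by simp
  have cQ: "isCont Q s0" unfolding Q_def by (intro continuous_intros cp ch)
  have cw: "isCont w s0" unfolding w_def
    by (rule isCont_o2[OF cQ]) (simp add: QW isCont_branch_inverse[OF W(1)])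
  have cg: "isCont (\<lambda>s. growth (w s)) s0"
    unfolding growth_def using branch_trig(1)[OF W(1)] by (intro continuous_intros cw) (simp add: wW)
  have cl: "isCont l s0"
    unfolding l_def using tau by (simp add: isCont_def complex_eq_iff Complex_eq)
      (use cg cw cp in \<open>intro tendsto_intros; auto simp: isCont_def\<close>)
  have "Q s0 > pi / 2 + 2 * real j * pi"
    using modulus_gt[OF W(1)] W(1) unfolding QW by (auto simp: branch_def)
  then have "eventually (\<lambda>s. Q s > pi / 2 + 2 * real j * pi \<and> p s > 0 \<and> h s > 1) (nhds s0)"
    using cQ cp ch p0 h0 unfolding continuous_at tendsto_at_iff_tendsto_nhds
    by (intro eventually_conj order_tendstoD)
  then obtain d where d: "d > 0"
    "\<And>s. \<bar>s - s0\<bar> < d \<Longrightarrow> Q s > pi / 2 + 2 * real j * pi \<and> p s > 0 \<and> h s > 1"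
    unfolding eventually_nhds_metric dist_real_def by metis
  have ws: "w s \<in> branch j" "modulus (w s) = h s * p s * exp (p s)" if "\<bar>s - s0\<bar> < d" for s
  proof -
    have "Q s \<in> modulus ` branch j" using modulus_surj[of j "Q s"] d(2)[OF that] by (auto simp: image_iff) metis
    then show "w s \<in> branch j" "modulus (w s) = h s * p s * exp (p s)"
      unfolding w_def by (auto intro: inv_into_into simp: f_inv_into_f simp flip: Q_def)
  qed
  have lt: "l s * of_real tau = Complex (growth (w s) - p s) (w s)" for s
    using tau by (simp add: l_def complex_eq_iff)
  show ?thesis
  proof (rule exI[of _ "W / tau"], rule exI[of _ d], rule exI[of _ l], intro conjI allI impI)
    show "W / tau * tau \<in> branch j" using W(1) tau by simp
    show "d > 0" by fact
    show "l s0 = \<i> * of_real (W / tau)" by (simp add: l_def complex_eq_iff wW gW)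
    show "isCont l s0" by fact
    fix s assume sd: "\<bar>s - s0\<bar> < d"
    show "l s * of_real tau = - of_real (p s) - of_real (p s * h s) * exp (- l s * of_real tau)"
      using branch_root[OF ws[OF sd]] lt[of s] by simp
    have "sgn (Re (l s)) = sgn (growth (w s) - p s)" using tau by (simp add: l_def sgn_divide)
    also have "\<dots> = sgn (gap j (p s) (h s))" using branch_sign ws[OF sd] d(2)[OF sd] by blast
    finally show "sgn (Re (l s)) = sgn (gap j (p s) (h s))" .
  qed
qed

lemma gap_has_derivative:
  assumes p: "(p has_real_derivative p') (at s)" and h: "(h has_real_derivative h') (at s)"
    and h1: "h s > 1"
  shows "((\<lambda>s. gap j (p s) (h s)) has_real_derivative
     p' * sqrt ((h s)\<^sup>2 - 1) + p s * h s * h' / sqrt ((h s)\<^sup>2 - 1) + h' / (h s * sqrt ((h s)\<^sup>2 - 1))) (at s)"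
proof -
  have "isCont h s" using h by (rule DERIV_isCont)
  then have ev: "eventually (\<lambda>t. h t > 1) (nhds s)"
    using h1 unfolding continuous_at tendsto_at_iff_tendsto_nhds by (rule order_tendstoD)
  have b: "-1 < - 1 / h s" "- 1 / h s < 1" using h1 by (auto simp: field_simps)
  have sq: "(h s)\<^sup>2 > 1" using h1 by simp
  have r: "sqrt (1 - (1 / h s)\<^sup>2) = sqrt ((h s)\<^sup>2 - 1) / h s"
  proof -
    have "1 - (1 / h s)\<^sup>2 = ((h s)\<^sup>2 - 1) / (h s)\<^sup>2" using h1 by (simp add: field_simps)
    then show ?thesis using h1 by (simp add: real_sqrt_divide)
  qed
  have "((\<lambda>s. p s * sqrt ((h s)\<^sup>2 - 1) - arccos (- 1 / h s) - 2 * real j * pi) has_real_derivative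
     p' * sqrt ((h s)\<^sup>2 - 1) + p s * h s * h' / sqrt ((h s)\<^sup>2 - 1) + h' / (h s * sqrt ((h s)\<^sup>2 - 1))) (at s)"
  proof -
    have "((\<lambda>s. sqrt ((h s)\<^sup>2 - 1)) has_real_derivative h s * h' / sqrt ((h s)\<^sup>2 - 1)) (at s)"
      using sq by (auto intro!: derivative_eq_intros h simp: field_simps)
    moreover have "((\<lambda>s. arccos (- 1 / h s)) has_real_derivative - (h' / (h s * sqrt ((h s)\<^sup>2 - 1)))) (at s)"
    proof -
      have "((\<lambda>s. - 1 / h s) has_real_derivative h' / (h s)\<^sup>2) (at s)"
        using h1 by (auto intro!: derivative_eq_intros h simp: power2_eq_square)
      from DERIV_chain2[OF DERIV_arccos[OF b] this] show ?thesis
        using r h1 by (simp add: power2_eq_square field_simps)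
    qed
    ultimately have "((\<lambda>s. p s * sqrt ((h s)\<^sup>2 - 1) - arccos (- 1 / h s) - 2 * real j * pi) has_real_derivative
        p' * sqrt ((h s)\<^sup>2 - 1) + h s * h' / sqrt ((h s)\<^sup>2 - 1) * p s
        - - (h' / (h s * sqrt ((h s)\<^sup>2 - 1))) - 0) (at s)"
      by (intro DERIV_diff DERIV_mult p DERIV_const)
    then show ?thesis by (simp add: mult_ac)
  qed
  moreover have "eventually (\<lambda>t. gap j (p t) (h t) = p t * sqrt ((h t)\<^sup>2 - 1) - arccos (- 1 / h t) - 2 * real j * pi) (nhds s)"
    using ev by eventually_elim (simp add: gap_def max_def)
  ultimately show ?thesis by (subst DERIV_cong_ev[OF refl _ refl])
qed

lemma isCont_gap:
  assumes "isCont p s" "isCont h s"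
  shows "isCont (\<lambda>s. gap j (p s) (h s)) s"
proof -
  have m: "isCont (\<lambda>s. max 1 (h s)) s" using assms by (intro continuous_intros)
  have "isCont (\<lambda>s. arccos (- 1 / max 1 (h s))) s"
  proof -
    have c: "continuous_on {-1..1} arccos" by (rule continuous_on_arccos')
    have i: "isCont (\<lambda>s. - 1 / max 1 (h s)) s" by (intro continuous_intros m) auto
    have "\<forall>t. - 1 / max 1 (h t) \<in> {-1..1}" by (auto simp: field_simps max_def)
    then have "((\<lambda>s. arccos (- 1 / max 1 (h s))) \<longlongrightarrow> arccos (- 1 / max 1 (h s))) (at s)"
      using i unfolding isCont_def by (intro continuous_on_tendsto_compose[OF c]) auto
    then show ?thesis by (simp add: isCont_def)
  qed
  then show ?thesis unfolding gap_def using assms m by (intro continuous_intros)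
qed

lemma implicit_derivative:
  fixes L nu c u :: "real \<Rightarrow> real"
  assumes dL: "(L has_real_derivative - k) (at (u s0))" and k: "k \<ge> 0"
    and anti: "\<And>x y. x \<le> y \<Longrightarrow> L y \<le> L x"
    and dnu: "(nu has_real_derivative nu') (at s0)" and dc: "(c has_real_derivative c') (at s0)"
    and nu: "nu s0 > 0"
    and ev: "eventually (\<lambda>s. L (u s) - nu s * u s = c s) (nhds s0)"
  shows "(u has_real_derivative - (u s0 * nu' + c') / (k + nu s0)) (at s0)"
proof -
  let ?u0 = "u s0"
  have eq0: "L ?u0 - nu s0 * ?u0 = c s0" using ev by (rule eventually_nhds_x_imp_x)
  have tnu: "(nu \<longlongrightarrow> nu s0) (nhds s0)" and tc: "(c \<longlongrightarrow> c s0) (nhds s0)"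
    using DERIV_isCont[OF dnu] DERIV_isCont[OF dc] by (simp_all add: continuous_at tendsto_at_iff_tendsto_nhds)
  have nupos: "eventually (\<lambda>s. nu s > 0) (nhds s0)" using tnu nu by (rule order_tendstoD)
  have less: "x < y" if "L y - a * y < L x - a * x" "a > 0" for x y a
  proof (rule ccontr)
    assume "\<not> x < y"
    then have "L x \<le> L y" "a * y \<le> a * x" using that by (auto intro: anti mult_left_mono)
    then show False using that by linarith
  qed
  have tu: "(u \<longlongrightarrow> ?u0) (nhds s0)"
  proof (rule order_tendstoI)
    fix x assume x: "x < ?u0"
    have "L x - nu s0 * x > c s0" using x anti[of x ?u0] eq0 mult_strict_left_mono[OF x nu] by linarith
    then have "eventually (\<lambda>s. L x - nu s * x - c s > 0) (nhds s0)"
      by (intro order_tendstoD(1)[where y = "L x - nu s0 * x - c s0"] tendsto_intros tnu tc) auto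
    with ev nupos show "eventually (\<lambda>s. x < u s) (nhds s0)"
      by eventually_elim (rule less[where a = "nu _"], auto)
  next
    fix x assume x: "x > ?u0"
    have "L x - nu s0 * x < c s0" using x anti[of ?u0 x] eq0 mult_strict_left_mono[OF x nu] by linarith
    then have "eventually (\<lambda>s. L x - nu s * x - c s < 0) (nhds s0)"
      by (intro order_tendstoD(2)[where y = "L x - nu s0 * x - c s0"] tendsto_intros tnu tc) auto
    with ev nupos show "eventually (\<lambda>s. u s < x) (nhds s0)"
      by eventually_elim (rule less[where a = "nu _"], auto)
  qed
  obtain g where g: "\<And>z. L z - L ?u0 = g z * (z - ?u0)" "isCont g ?u0" "g ?u0 = - k"
    using dL unfolding CARAT_DERIV by blast
  obtain g1 where g1: "\<And>z. nu z - nu s0 = g1 z * (z - s0)" "isCont g1 s0" "g1 s0 = nu'"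
    using dnu unfolding CARAT_DERIV by blast
  obtain g2 where g2: "\<And>z. c z - c s0 = g2 z * (z - s0)" "isCont g2 s0" "g2 s0 = c'"
    using dc unfolding CARAT_DERIV by blast
  have tg: "((\<lambda>s. g (u s)) \<longlongrightarrow> - k) (nhds s0)"
    using g(2,3) tu by (metis continuous_at tendsto_at_iff_tendsto_nhds filterlim_compose)
  have tg1: "(g1 \<longlongrightarrow> nu') (nhds s0)" and tg2: "(g2 \<longlongrightarrow> c') (nhds s0)"
    using g1(2,3) g2(2,3) by (auto simp: continuous_at tendsto_at_iff_tendsto_nhds)
  let ?q = "\<lambda>s. (?u0 * g1 s + g2 s) / (g (u s) - nu s)"
  have "eventually (\<lambda>s. g (u s) - nu s < 0) (nhds s0)"
    by (rule order_tendstoD(2)[OF tendsto_diff[OF tg tnu]]) (use k nu in simp)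
  with ev have e: "eventually (\<lambda>s. u s - ?u0 = ?q s * (s - s0)) (nhds s0)"
  proof eventually_elim
    case (elim s)
    have "(u s - ?u0) * (g (u s) - nu s) = ?u0 * (nu s - nu s0) + (c s - c s0)"
      using g(1)[of "u s"] elim(1) eq0 by (simp add: algebra_simps)
    also have "\<dots> = (?u0 * g1 s + g2 s) * (s - s0)" unfolding g1(1) g2(1) by (simp add: algebra_simps)
    finally show ?case using elim(2) by (simp add: field_simps)
  qed
  have "((\<lambda>s. ?q s) \<longlongrightarrow> (?u0 * nu' + c') / (- k - nu s0)) (nhds s0)"
    by (intro tendsto_intros tg tg1 tg2 tnu) (use k nu in simp)
  then have "((\<lambda>s. ?q s) \<longlongrightarrow> (?u0 * nu' + c') / (- k - nu s0)) (at s0)"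
    by (rule tendsto_mono[rotated]) (simp add: at_within_def)
  moreover have "eventually (\<lambda>s. ?q s = (u s - ?u0) / (s - s0)) (at s0)"
    using e unfolding eventually_at_filter by eventually_elim (simp add: field_simps)
  ultimately have "((\<lambda>s. (u s - ?u0) / (s - s0)) \<longlongrightarrow> (?u0 * nu' + c') / (- k - nu s0)) (at s0)"
    by (rule Lim_transform_eventually)
  moreover have "(?u0 * nu' + c') / (- k - nu s0) = - (?u0 * nu' + c') / (k + nu s0)"
    using k nu by (simp add: divide_simps) (simp add: algebra_simps)
  ultimately show ?thesis unfolding has_field_derivative_iff by simp
qed

section \<open>The Hill function in the logarithmic variable\<close>

definition log_hill :: "real \<Rightarrow> real \<Rightarrow> real" where
  "log_hill r u = ln (r + exp u) - ln (1 + exp u)"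

definition sens :: "real \<Rightarrow> real \<Rightarrow> real" where
  "sens r u = (r - 1) * exp u / ((r + exp u) * (1 + exp u))"

definition sens_slope :: "real \<Rightarrow> real \<Rightarrow> real" where
  "sens_slope r u = (r - (exp u)\<^sup>2) / ((r + exp u) * (1 + exp u))"

text \<open>With \<open>nu = 1/n\<close> and \<open>c = ln (\<gamma>/\<gamma>\<^sub>1)\<close> this is \<open>n ln (\<xi>/\<theta>)\<close> at the steady state \<open>\<xi>\<close>.\<close>
definition log_state :: "real \<Rightarrow> real \<Rightarrow> real \<Rightarrow> real" where
  "log_state r nu c = (SOME u. log_hill r u - nu * u = c)"

lemma log_hill_deriv:
  assumes "r > 1"
  shows "(log_hill r has_real_derivative - sens r u) (at u)"
proof -
  have "r + exp u > 0" "1 + exp u > 0" using assms by (auto intro: add_pos_pos)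
  then show ?thesis unfolding log_hill_def sens_def
    by (auto intro!: derivative_eq_intros simp: divide_simps) (auto simp: algebra_simps)
qed

lemma sens_pos: "r > 1 \<Longrightarrow> sens r u > 0"
  unfolding sens_def by (auto intro!: divide_pos_pos mult_pos_pos add_pos_pos)

lemma sens_deriv:
  assumes "r > 1"
  shows "(sens r has_real_derivative sens r u * sens_slope r u) (at u)"
proof -
  have "r + exp u > 0" "1 + exp u > 0" using assms by (auto intro: add_pos_pos)
  then show ?thesis unfolding sens_slope_def sens_def
    by (auto intro!: derivative_eq_intros simp: divide_simps) (auto simp: algebra_simps power2_eq_square)
qed

lemma isCont_sens: "r > 1 \<Longrightarrow> isCont (sens r) u"
  using sens_deriv DERIV_isCont by blast

lemma log_hill_antimono: "r > 1 \<Longrightarrow> x \<le> y \<Longrightarrow> log_hill r y \<le> log_hill r x"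
  by (rule DERIV_nonpos_imp_nonincreasing) (use log_hill_deriv sens_pos in \<open>force intro: less_imp_le\<close>)+

lemma exp_log_hill:
  assumes "r > 1"
  shows "exp (log_hill r u) = (r + exp u) / (1 + exp u)"
proof -
  have "r + exp u > 0" "1 + exp u > 0" using assms by (auto intro: add_pos_pos)
  then show ?thesis by (simp add: log_hill_def exp_diff)
qed

lemma log_hill_bounds:
  assumes "r > 1"
  shows "0 < log_hill r u" "log_hill r u < ln r"
proof -
  have p: "r + exp u > 0" "1 + exp u > 0" using assms by (auto intro: add_pos_pos)
  then have "exp 0 < exp (log_hill r u)" unfolding exp_log_hill[OF assms] using assms by (simp add: divide_simps)
  then show "0 < log_hill r u" by simp
  have "exp (log_hill r u) < exp (ln r)" unfolding exp_log_hill[OF assms] using p assms by (simp add: divide_simps algebra_simps)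
  then show "log_hill r u < ln r" by simp
qed

lemma log_state_exists:
  assumes r: "r > 1" and nu: "nu > 0"
  shows "\<exists>u. log_hill r u - nu * u = c"
proof -
  have "\<exists>u\<ge>- c / nu. u \<le> (ln r - c) / nu \<and> log_hill r u - nu * u = c"
  proof (rule IVT2)
    show "log_hill r ((ln r - c) / nu) - nu * ((ln r - c) / nu) \<le> c"
      using log_hill_bounds(2)[OF r, of "(ln r - c) / nu"] nu by simp
    show "c \<le> log_hill r (- c / nu) - nu * (- c / nu)"
      using log_hill_bounds(1)[OF r, of "- c / nu"] nu by simp
    show "- c / nu \<le> (ln r - c) / nu" using r nu by (intro divide_right_mono) auto
    show "\<forall>x. - c / nu \<le> x \<and> x \<le> (ln r - c) / nu \<longrightarrow> isCont (\<lambda>u. log_hill r u - nu * u) x"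
      using DERIV_isCont[OF log_hill_deriv[OF r]] by (auto intro!: continuous_intros)
  qed
  then show ?thesis by blast
qed

lemma log_state_less:
  assumes r: "r > 1" and nu: "nu > 0" and "x < y"
  shows "log_hill r y - nu * y < log_hill r x - nu * x"
  using log_hill_antimono[OF r, of x y] mult_strict_left_mono[OF \<open>x < y\<close> nu] \<open>x < y\<close> by linarith

lemma log_state_eq:
  assumes r: "r > 1" and nu: "nu > 0"
  shows "log_hill r (log_state r nu c) - nu * log_state r nu c = c"
  unfolding log_state_def using log_state_exists[OF r nu] by (rule someI_ex)

lemma log_state_unique:
  assumes r: "r > 1" and nu: "nu > 0" and "log_hill r u - nu * u = c"
  shows "log_state r nu c = u"
  using log_state_less[OF r nu] log_state_eq[OF r nu, of c] assms(3)
  by (metis linorder_neqE_linordered_idom less_irrefl)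

lemma sens_less_exp:
  assumes "r > 1"
  shows "sens r u < (r - 1) * exp u" "sens r u < (r - 1) * exp (- u)" "sens r u < 1"
proof -
  define y where "y = exp u"
  have y: "y > 0" by (simp add: y_def)
  have d: "(r + y) * (1 + y) > 0" using y assms by (intro mult_pos_pos) auto
  have e: "exp (- u) = 1 / y" by (simp add: y_def exp_minus field_simps)
  have "1 < (r + y) * (1 + y)" using y assms by (intro less_1_mult) auto
  then have "(r - 1) * y * 1 < (r - 1) * y * ((r + y) * (1 + y))"
    using y assms by (intro mult_strict_left_mono mult_pos_pos) auto
  then show "sens r u < (r - 1) * exp u"
    unfolding sens_def y_def[symmetric] using d by (simp add: divide_less_eq)
  have q: "y * y < (r + y) * (1 + y)" using y assms by (intro mult_strict_mono) auto
  then have "(r - 1) * (y * y) < (r - 1) * ((r + y) * (1 + y))"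
    using assms by (intro mult_strict_left_mono) auto
  then show "sens r u < (r - 1) * exp (- u)"
    unfolding sens_def y_def[symmetric] e using d y by (simp add: divide_simps mult_ac)
  have "r * y < (r + y) * (1 + y)" using y assms by (simp add: algebra_simps add_pos_pos)
  then have "(r - 1) * y < (r + y) * (1 + y)" using y by (simp add: left_diff_distrib)
  then show "sens r u < 1" unfolding sens_def y_def[symmetric] using d by (simp add: divide_less_eq)
qed

lemma sens_le_max:
  assumes "r > 1"
  shows "sens r u \<le> (sqrt r - 1) / (sqrt r + 1)"
proof -
  define y s where "y = exp u" and "s = sqrt r"
  have y: "y > 0" and s: "s > 1" and r: "r = s\<^sup>2" using assms by (auto simp: y_def s_def)
  have d: "(r + y) * (1 + y) > 0" using y assms by (intro mult_pos_pos) auto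
  have "y * (s + 1)\<^sup>2 \<le> (r + y) * (1 + y)"
    using zero_le_power2[of "s - y"] unfolding r by (simp add: power2_eq_square algebra_simps)
  then have "(s - 1) * (y * (s + 1)\<^sup>2) \<le> (s - 1) * ((r + y) * (1 + y))"
    using s by (intro mult_left_mono) auto
  moreover have "(s - 1) * (y * (s + 1)\<^sup>2) = (r - 1) * y * (s + 1)"
    unfolding r by (simp add: power2_eq_square algebra_simps)
  ultimately show ?thesis unfolding sens_def y_def[symmetric] s_def[symmetric]
    using d s by (simp add: divide_simps)
qed

lemma exp_dominates_linear:
  fixes n l K :: real
  assumes "l > 0" "n > 0" "n \<ge> 2 * K / l\<^sup>2"
  shows "n * K \<le> exp (n * l)"
proof -
  have "n * K \<le> (n * l)\<^sup>2 / 2"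
    using mult_left_mono[OF assms(3), of n] assms(1,2) by (simp add: field_simps power2_eq_square)
  also have "\<dots> \<le> exp (n * l)"
  proof -
    have "n * l \<ge> 0" using assms by simp
    then show ?thesis using exp_lower_Taylor_quadratic[of "n * l"] by linarith
  qed
  finally show ?thesis .
qed

lemma stable_criterion:
  fixes z :: complex
  assumes p: "p > 0" and h: "\<bar>h\<bar> < 1" and t: "tau > 0"
    and z: "z = - of_real p - of_real (p * h) * exp (- z * of_real tau)"
  shows "Re z < 0"
proof (rule ccontr)
  assume "\<not> Re z < 0"
  then have re: "Re z \<ge> 0" by simp
  have "z + of_real p = - (of_real (p * h) * exp (- z * of_real tau))"
    by (subst z) simp
  then have "norm (z + of_real p) = p * \<bar>h\<bar> * exp (- Re z * tau)"
    using p by (simp add: norm_mult norm_exp_eq_Re abs_mult)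
  also have "\<dots> \<le> p * \<bar>h\<bar> * 1" using re t p by (intro mult_left_mono) auto
  also have "\<dots> < p" using h p by simp
  also have "p \<le> Re (z + of_real p)" using re by simp
  also have "\<dots> \<le> norm (z + of_real p)" by (rule complex_Re_le_cmod)
  finally show False by simp
qed

text \<open>If the conclusion failed then, with \<open>\<rho> = (r - 1)/(r + 1)\<close> and \<open>t = (1 - y)/(1 + y)\<close>, one would have
  \<open>t < \<rho>/10\<close>, so that \<open>h\<close> is too close to its value \<open>H\<close> at \<open>y = 1\<close> for the last hypothesis.\<close>
lemma transversality_bound:
  fixes n r y :: real
  assumes n: "n > 0" and r: "r > 1" and y: "0 < y" "y < 1"
  defines "h \<equiv> n * (r - 1) * y / ((r + y) * (1 + y))"
  defines "H \<equiv> n * (r - 1) / (2 * (r + 1))"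
  assumes h: "h > 1" and hH: "(h\<^sup>2 - 1) * ((r + 1) / 2)\<^sup>2 < H\<^sup>2 - 1"
  shows "(h\<^sup>2 - 1) * (1 + h) \<le> h\<^sup>2 * (h + n * ((1 - y) / (1 + y)))"
proof (rule ccontr)
  define rho t where "rho = (r - 1) / (r + 1)" and "t = (1 - y) / (1 + y)"
  assume "\<not> ?thesis"
  then have neg: "h\<^sup>2 * (n * t) < h\<^sup>2 - h - 1"
    by (simp add: t_def algebra_simps power2_eq_square)
  have rho: "0 < rho" "rho < 1" and t: "0 < t" "t < 1"
    using r y by (auto simp: rho_def t_def)
  have Hrho: "2 * H = n * rho" using r by (simp add: H_def rho_def divide_simps)
  have H0: "H > 0" using n r by (simp add: H_def)
  have hrel: "h * (1 + t * rho) = H * (1 - t\<^sup>2)"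
  proof -
    have e1: "1 + t * rho = 2 * (r + y) / ((1 + y) * (r + 1))"
      using r y by (simp add: t_def rho_def divide_simps) (simp add: algebra_simps)
    have e2: "1 - t\<^sup>2 = 4 * y / (1 + y)\<^sup>2"
      using y by (simp add: t_def divide_simps) (simp add: algebra_simps power2_eq_square)
    show ?thesis unfolding e1 e2 h_def H_def
      using r y by (simp add: divide_simps) (simp add: algebra_simps power2_eq_square)
  qed
  have rr: "(r + 1) / 2 = 1 / (1 - rho)" using r by (simp add: rho_def field_simps)
  have prem: "h\<^sup>2 - 1 < (1 - rho)\<^sup>2 * (H\<^sup>2 - 1)"
    using hH rho unfolding rr by (simp add: power_divide field_simps)
  have "0 < h\<^sup>2 * (n * t)" using h n t by simp
  then have h2: "h\<^sup>2 > 2" using neg h by linarith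
  have hleH: "h \<le> H"
  proof -
    have "h * 1 \<le> h * (1 + t * rho)" using h t rho by (intro mult_left_mono) auto
    also have "\<dots> = H * (1 - t\<^sup>2)" by (rule hrel)
    also have "\<dots> \<le> H * 1" using H0 by (intro mult_left_mono) auto
    finally show ?thesis by simp
  qed
  have H2: "H\<^sup>2 > 2" using h2 hleH h power_mono[of h H 2] by linarith
  have t10: "t < rho / 10"
  proof -
    have "0 \<le> (h - 11/4)\<^sup>2 * (h + 1/2)" using h by (intro mult_nonneg_nonneg) auto
    also have "\<dots> = h\<^sup>2 * h - 5 * h\<^sup>2 + 77/16 * h + 121/32"
      by (simp add: power2_eq_square field_simps)
    finally have "0 \<le> h\<^sup>2 * h - 5 * h\<^sup>2 + 77/16 * h + 121/32" .
    moreover have "5 * (A - h - 1) \<le> B" if "0 \<le> B - 5 * A + 77/16 * h + 121/32" for A B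
      using that h by (simp add: field_simps)
    ultimately have "5 * (h\<^sup>2 - h - 1) \<le> h\<^sup>2 * h" by blast
    moreover have "5 * (h\<^sup>2 * (n * t)) < 5 * (h\<^sup>2 - h - 1)" using neg by simp
    ultimately have "5 * (h\<^sup>2 * (n * t)) < h\<^sup>2 * h" by (rule order.strict_trans2[rotated])
    then have "h\<^sup>2 * (5 * (n * t)) < h\<^sup>2 * h" by (simp only: mult.left_commute)
    then have "5 * (n * t) < h" using h by simp
    then have "n * (10 * t) < n * rho" using hleH Hrho by linarith
    then show ?thesis using n by simp
  qed
  have hlow: "H * (1 - 11/100 * rho\<^sup>2) \<le> h"
  proof -
    have "t\<^sup>2 \<le> (rho / 10)\<^sup>2" using t t10 by (intro power_mono) auto
    then have "H * (1 - (rho / 10)\<^sup>2) \<le> h * (1 + t * rho)" unfolding hrel using H0 by (intro mult_left_mono) auto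
    also have "\<dots> \<le> h * (1 + rho / 10 * rho)" using h t10 rho by (intro mult_left_mono add_left_mono mult_right_mono) auto
    finally have a: "H * (1 - (rho / 10)\<^sup>2) \<le> h * (1 + rho\<^sup>2 / 10)" by (simp add: power2_eq_square)
    have "(1 - 11/100 * rho\<^sup>2) * (1 + rho\<^sup>2 / 10) \<le> 1 - (rho / 10)\<^sup>2"
      using rho by (simp add: power2_eq_square algebra_simps)
    then have "H * ((1 - 11/100 * rho\<^sup>2) * (1 + rho\<^sup>2 / 10)) \<le> H * (1 - (rho / 10)\<^sup>2)"
      using H0 by (intro mult_left_mono) auto
    then have "(H * (1 - 11/100 * rho\<^sup>2)) * (1 + rho\<^sup>2 / 10) \<le> h * (1 + rho\<^sup>2 / 10)"
      using a by (simp add: mult.assoc)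
    moreover have "1 + rho\<^sup>2 / 10 > 0" by (simp add: add_pos_nonneg)
    ultimately show ?thesis by (simp only: mult_le_cancel_right_pos)
  qed
  have rho2: "rho\<^sup>2 < 1" using rho by (simp add: power_less_one_iff abs_square_less_1)
  have "H\<^sup>2 * (1 - 11/100 * rho\<^sup>2)\<^sup>2 \<le> h\<^sup>2"
    using power_mono[OF hlow, of 2] H0 rho2 by (simp add: power_mult_distrib)
  moreover have "H\<^sup>2 * (1 - 22/100 * rho\<^sup>2) \<le> H\<^sup>2 * (1 - 11/100 * rho\<^sup>2)\<^sup>2"
    using rho by (intro mult_left_mono) (auto simp: power2_eq_square algebra_simps)
  ultimately have "H\<^sup>2 * (1 - 22/100 * rho\<^sup>2) - 1 < (1 - rho)\<^sup>2 * (H\<^sup>2 - 1)" using prem by linarith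
  then have "rho * (H\<^sup>2 * (2 - 122/100 * rho)) < rho * (2 - rho)"
    by (simp add: power2_eq_square algebra_simps)
  then have "H\<^sup>2 * (2 - 122/100 * rho) < 2 - rho" using rho by simp
  moreover have "2 * (2 - 122/100 * rho) \<le> H\<^sup>2 * (2 - 122/100 * rho)"
    using H2 rho by (intro mult_right_mono) auto
  ultimately have "2 * (2 - 122/100 * rho) < 2 - rho" by (rule order.strict_trans1[rotated])
  then show False using rho by (simp add: field_simps)
qed

text \<open>The left side is, up to a positive factor, the derivative of \<open>h\<close> in \<open>n\<close> at fixed \<open>\<gamma>\<close>.\<close>
lemma sens_slope_bound:
  assumes r: "r > 1" and n: "n > 0" and eq: "log_hill r u - u / n = c" and c: "0 < c" "c < ln r"
  shows "1 + n * sens r u + sens_slope r u * u > 0"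
proof -
  define y where "y = exp u"
  have y: "y > 0" by (simp add: y_def)
  have d: "r + y > 0" "1 + y > 0" using y r by auto
  have S: "sens r u = (r - 1) * y / ((r + y) * (1 + y))"
    "sens_slope r u = (r - y\<^sup>2) / ((r + y) * (1 + y))" by (simp_all add: sens_def sens_slope_def y_def)
  have u: "u = n * (log_hill r u - c)" using eq n by (auto simp: field_simps)
  have L: "log_hill r u = ln ((r + y) / (1 + y))" using d by (simp add: log_hill_def y_def ln_div)
  show ?thesis
  proof (cases "u \<ge> 0")
    case True
    have "sens_slope r u + y / (r + y) = 1 / (1 + y)"
      unfolding S using d by (simp add: divide_simps) (simp add: algebra_simps power2_eq_square)
    then have "sens_slope r u \<ge> - (y / (r + y))" using d by (smt (verit) divide_pos_pos)
    then have a: "sens_slope r u * u \<ge> - (y / (r + y)) * u" using True by (rule mult_right_mono)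
    have "log_hill r u \<le> (r + y) / (1 + y) - 1" unfolding L using d by (intro ln_le_minus_one) simp
    also have "\<dots> = (r - 1) / (1 + y)" using d by (simp add: field_simps)
    finally have "log_hill r u - c \<le> (r - 1) / (1 + y)" using c by linarith
    then have "u \<le> n * ((r - 1) / (1 + y))" using n u by (metis mult_left_mono less_imp_le)
    then have "y / (r + y) * u \<le> y / (r + y) * (n * ((r - 1) / (1 + y)))" using y d by (intro mult_left_mono) auto
    also have "\<dots> = n * sens r u" unfolding S by simp
    finally show ?thesis using a by linarith
  next
    case False
    have "1 / (1 + y) - sens_slope r u = y / (r + y)"
      unfolding S using d by (simp add: divide_simps) (simp add: algebra_simps power2_eq_square)
    then have "sens_slope r u \<le> 1 / (1 + y)" using d y by (smt (verit) divide_pos_pos)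
    then have a: "sens_slope r u * u \<ge> 1 / (1 + y) * u" using False by (intro mult_right_mono_neg) auto
    have "ln r - log_hill r u = ln (r * (1 + y) / (r + y))"
      unfolding L using d r by (simp add: ln_div ln_mult)
    also have "\<dots> \<le> r * (1 + y) / (r + y) - 1" using d r by (intro ln_le_minus_one) simp
    also have "\<dots> = (r - 1) * y / (r + y)" using d by (simp add: field_simps)
    finally have "c - log_hill r u \<le> (r - 1) * y / (r + y)" using c by linarith
    then have "n * (c - log_hill r u) \<le> n * ((r - 1) * y / (r + y))" using n by (intro mult_left_mono) auto
    then have "- u \<le> n * ((r - 1) * y / (r + y))" using u by (simp add: algebra_simps)
    then have "1 / (1 + y) * (- u) \<le> 1 / (1 + y) * (n * ((r - 1) * y / (r + y)))" using d by (intro mult_left_mono) auto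
    also have "\<dots> = n * sens r u" unfolding S by simp
    finally show ?thesis using a by simp
  qed
qed

section \<open>Steady states and bifurcations of the delay equation\<close>

locale hill_model =
  fixes beta mu tau gm gp th :: real
  assumes beta: "beta > 0" and tau: "tau > 0" and gp: "gp > 0" and th: "th > 0" and decr: "gm > gp"
begin

definition "r = gm / gp"
definition "g1 = beta * exp (- mu * tau) * gp / th"

lemma r_gt_1: "r > 1" using decr gp by (simp add: r_def)
lemma g1_pos: "g1 > 0" using beta gp th by (simp add: g1_def)

lemma hill_eq:
  assumes "x > 0"
  shows "hill gm gp th n x = gp * exp (log_hill r (n * ln (x / th)))"
proof -
  let ?y = "exp (n * ln (x / th))"
  have y: "x powr n = th powr n * ?y"
    using assms th by (simp add: powr_def ln_div algebra_simps flip: exp_add)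
  have d: "1 + ?y > 0" and t: "th powr n > 0" using th by (auto intro: add_pos_pos)
  have "hill gm gp th n x = (th powr n * (gm + gp * ?y)) / (th powr n * (1 + ?y))"
    unfolding hill_def y by (simp add: algebra_simps)
  also have "\<dots> = (gm + gp * ?y) / (1 + ?y)" using t by simp
  also have "\<dots> = gp * exp (log_hill r (n * ln (x / th)))"
    unfolding exp_log_hill[OF r_gt_1] using gp by (simp add: r_def distrib_left)
  finally show ?thesis .
qed

lemma deriv_hill:
  assumes "x > 0"
  shows "deriv (hill gm gp th n) x = - hill gm gp th n x * (n * sens r (n * ln (x / th))) / x"
proof (rule DERIV_imp_deriv)
  have "((\<lambda>x. n * ln (x / th)) has_real_derivative n / x) (at x)"
    using assms th by (auto intro!: derivative_eq_intros simp: field_simps)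
  from DERIV_cmult[OF DERIV_chain2[OF DERIV_exp DERIV_chain2[OF log_hill_deriv[OF r_gt_1] this]], of gp]
  have "((\<lambda>x. gp * exp (log_hill r (n * ln (x / th)))) has_real_derivative
      - hill gm gp th n x * (n * sens r (n * ln (x / th))) / x) (at x)"
    using assms by (simp add: hill_eq mult_ac)
  then show "(hill gm gp th n has_real_derivative
      - hill gm gp th n x * (n * sens r (n * ln (x / th))) / x) (at x)"
    by (rule has_field_derivative_transform_within_open[of _ _ _ "{0<..}"]) (use assms hill_eq in auto)
qed

lemma steady_iff:
  assumes n: "n > 0"
  shows "steady beta mu tau gm gp th n gam xi \<longleftrightarrow> xi > 0 \<and> gam > 0 \<and>
    log_hill r (n * ln (xi / th)) - 1 / n * (n * ln (xi / th)) = ln (gam / g1)"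
proof (cases "xi > 0")
  case True
  let ?u = "n * ln (xi / th)"
  have "beta * exp (- mu * tau) * hill gm gp th n xi = g1 * exp (log_hill r ?u) * th"
    using True th by (simp add: hill_eq g1_def)
  then have "steady beta mu tau gm gp th n gam xi \<longleftrightarrow> g1 * exp (log_hill r ?u) * th = gam * xi"
    using True by (simp add: steady_def)
  also have "\<dots> \<longleftrightarrow> exp (log_hill r ?u - ln (xi / th)) = gam / g1"
    using True th g1_pos by (simp add: exp_diff field_simps)
  also have "\<dots> \<longleftrightarrow> gam > 0 \<and> log_hill r ?u - ln (xi / th) = ln (gam / g1)"
    using g1_pos by (metis exp_gt_zero exp_ln ln_exp zero_less_divide_iff less_asym)
  finally show ?thesis using True n by simp
qed (simp add: steady_def)

lemma steady_log_state:
  assumes n: "n > 0" and gam: "gam > 0"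
  shows "steady beta mu tau gm gp th n gam (th * exp (log_state r (1 / n) (ln (gam / g1)) / n))"
  using log_state_eq[OF r_gt_1, of "1 / n" "ln (gam / g1)"] n gam th by (simp add: steady_iff)

lemma char_root_iff:
  assumes n: "n > 0" and st: "steady beta mu tau gm gp th n gam xi"
  defines "h \<equiv> n * sens r (n * ln (xi / th))"
  shows "char_root beta mu tau gm gp th n gam xi lam \<longleftrightarrow>
    lam = - of_real gam - of_real (gam * h) * exp (- lam * of_real tau)"
proof -
  have xi: "xi > 0" and s: "beta * exp (- mu * tau) * hill gm gp th n xi = gam * xi"
    using st by (auto simp: steady_def)
  have "beta * exp (- mu * tau) * deriv (hill gm gp th n) xi
      = - (beta * exp (- mu * tau) * hill gm gp th n xi * h / xi)"
    unfolding deriv_hill[OF xi] h_def by simp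
  also have "\<dots> = - (gam * h)" unfolding s using xi by simp
  finally have e: "beta * exp (- mu * tau) * deriv (hill gm gp th n) xi = - (gam * h)" .
  show ?thesis unfolding char_root_def e by simp
qed

lemma stable_if_sens:
  assumes n: "n > 0" and st: "steady beta mu tau gm gp th n gam xi"
    and h: "n * sens r (n * ln (xi / th)) < 1"
  shows "asym_stable beta mu tau gm gp th n gam xi"
proof -
  have "0 < n * sens r (n * ln (xi / th))" using n sens_pos[OF r_gt_1] by simp
  then have "\<bar>n * sens r (n * ln (xi / th))\<bar> < 1" using h by linarith
  then show ?thesis unfolding asym_stable_def char_root_iff[OF n st]
    using stable_criterion[OF _ _ tau] st steady_iff[OF n] by blast
qed

lemma char_root_cnj:
  "char_root beta mu tau gm gp th n gam xi lam \<Longrightarrow> char_root beta mu tau gm gp th n gam xi (cnj lam)"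
  unfolding char_root_def by (drule arg_cong[where f = cnj]) (simp add: exp_cnj)

lemma log_state_deriv:
  assumes dN: "(N has_real_derivative N') (at s0)" and dG: "(G has_real_derivative G') (at s0)"
    and N0: "N s0 > 0" and G0: "G s0 > 0"
  defines "u \<equiv> \<lambda>s. log_state r (1 / N s) (ln (G s / g1))"
  shows "(u has_real_derivative (u s0 * N' / (N s0)\<^sup>2 - G' / G s0) / (sens r (u s0) + 1 / N s0)) (at s0)"
proof -
  have "((\<lambda>s. 1 / N s) has_real_derivative - N' / (N s0)\<^sup>2) (at s0)"
    using N0 by (auto intro!: derivative_eq_intros dN simp: power2_eq_square)
  moreover have "((\<lambda>s. ln (G s / g1)) has_real_derivative G' / G s0) (at s0)"
    using G0 g1_pos by (auto intro!: derivative_eq_intros dG)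
  moreover have "eventually (\<lambda>s. N s > 0) (nhds s0)"
    using DERIV_isCont[OF dN] N0 unfolding continuous_at tendsto_at_iff_tendsto_nhds by (rule order_tendstoD)
  then have "eventually (\<lambda>s. log_hill r (u s) - 1 / N s * u s = ln (G s / g1)) (nhds s0)"
    by eventually_elim (simp only: u_def log_state_eq[OF r_gt_1] zero_less_divide_1_iff)
  ultimately have "(u has_real_derivative - (u s0 * (- N' / (N s0)\<^sup>2) + G' / G s0) / (sens r (u s0) + 1 / N s0)) (at s0)"
    by (intro implicit_derivative[where L = "log_hill r" and nu = "\<lambda>s. 1 / N s" and c = "\<lambda>s. ln (G s / g1)"]
          log_hill_deriv[OF r_gt_1] less_imp_le[OF sens_pos[OF r_gt_1]] log_hill_antimono[OF r_gt_1])
       (use N0 in auto)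
  then show ?thesis by simp
qed

text \<open>\<open>E\<close> is the derivative of the gap along the parameter, multiplied by \<open>h \<surd>(h\<^sup>2 - 1)\<close>.\<close>
lemma hopf_crossing:
  assumes dN: "(N has_real_derivative N') (at s0)" and dG: "(G has_real_derivative G') (at s0)"
    and N0: "N s0 > 0" and G0: "G s0 > 0"
  defines "u \<equiv> log_state r (1 / N s0) (ln (G s0 / g1))"
  defines "h \<equiv> N s0 * sens r u"
  defines "h' \<equiv> N' * sens r u + N s0 * (sens r u * sens_slope r u *
      ((u * N' / (N s0)\<^sup>2 - G' / G s0) / (sens r u + 1 / N s0)))"
  defines "E \<equiv> G' * tau * (h\<^sup>2 - 1) * h + G s0 * tau * h\<^sup>2 * h' + h'"
  assumes gap0: "gap j (G s0 * tau) h = 0"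
  shows "E > 0 \<Longrightarrow> \<exists>om. om * tau \<in> branch j \<and>
        hopf_LR (\<lambda>s. char_root_at beta mu tau gm gp th (N s) (G s)) s0 om"
    and "E < 0 \<Longrightarrow> \<exists>om. om * tau \<in> branch j \<and>
        hopf_RL (\<lambda>s. char_root_at beta mu tau gm gp th (N s) (G s)) s0 om"
proof -
  define us where "us s = log_state r (1 / N s) (ln (G s / g1))" for s
  define p where "p s = G s * tau" for s
  define hs where "hs s = N s * sens r (us s)" for s
  have u: "us s0 = u" and hs0: "hs s0 = h" by (simp_all add: us_def u_def hs_def h_def)
  have du: "(us has_real_derivative ((u * N' / (N s0)\<^sup>2 - G' / G s0) / (sens r u + 1 / N s0))) (at s0)"
    using log_state_deriv[OF dN dG N0 G0] unfolding us_def u_def .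
  have dp: "(p has_real_derivative G' * tau) (at s0)" unfolding p_def by (rule DERIV_cmult_right[OF dG])
  have ds: "((\<lambda>s. sens r (us s)) has_real_derivative sens r u * sens_slope r u *
      ((u * N' / (N s0)\<^sup>2 - G' / G s0) / (sens r u + 1 / N s0))) (at s0)"
    by (rule DERIV_chain2[OF _ du]) (simp add: u sens_deriv[OF r_gt_1])
  have dh: "(hs has_real_derivative h') (at s0)"
    unfolding hs_def h'_def using DERIV_mult[OF dN ds] by (simp add: u mult_ac add.commute)
  have gp0: "gap j (p s0) (hs s0) = 0" using gap0 by (simp add: p_def hs0)
  have h1: "h > 1" using gap_pos_D[of j "G s0 * tau" h] gap0 by simp
  define S where "S = sqrt (h\<^sup>2 - 1)"
  have S: "S > 0" "S\<^sup>2 = h\<^sup>2 - 1" using h1 by (auto simp: S_def)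
  have dgap: "((\<lambda>s. gap j (p s) (hs s)) has_real_derivative E / (h * S)) (at s0)"
  proof -
    have "E / (h * S) = G' * tau * S + G s0 * tau * h * h' / S + h' / (h * S)"
      unfolding E_def S(2)[symmetric] using S(1) h1 by (simp add: field_simps power2_eq_square)
    then show ?thesis using gap_has_derivative[OF dp dh, of j] h1 unfolding hs0 S_def[symmetric]
      by (simp add: p_def)
  qed
  have "p s0 > 0" using G0 tau by (simp add: p_def)
  from crossing_branch[OF tau DERIV_isCont[OF dp] DERIV_isCont[OF dh] this gp0]
  obtain om d l where om: "om * tau \<in> branch j" and d: "d > 0" and l0: "l s0 = \<i> * of_real om"
    and lc: "isCont l s0" and
    lr: "\<And>s. \<bar>s - s0\<bar> < d \<Longrightarrow>
       l s * of_real tau = - of_real (p s) - of_real (p s * hs s) * exp (- l s * of_real tau)" and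
    ls: "\<And>s. \<bar>s - s0\<bar> < d \<Longrightarrow> sgn (Re (l s)) = sgn (gap j (p s) (hs s))"
    by (elim exE conjE) simp
  have "om * tau > 0" using branch_trig(3)[OF om] by linarith
  then have om0: "om > 0" using tau by (simp add: zero_less_mult_iff)
  have "eventually (\<lambda>s. N s > 0 \<and> G s > 0) (nhds s0)"
    using DERIV_isCont[OF dN] DERIV_isCont[OF dG] N0 G0
    unfolding continuous_at tendsto_at_iff_tendsto_nhds by (intro eventually_conj order_tendstoD)
  then obtain e where e: "e > 0" "\<And>s. \<bar>s - s0\<bar> < e \<Longrightarrow> N s > 0 \<and> G s > 0"
    unfolding eventually_nhds_metric dist_real_def by metis
  have root: "char_root_at beta mu tau gm gp th (N s) (G s) (l s) \<and>
      char_root_at beta mu tau gm gp th (N s) (G s) (cnj (l s))" if "\<bar>s - s0\<bar> < d" "\<bar>s - s0\<bar> < e" for s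
  proof -
    have NG: "N s > 0" "G s > 0" using e(2) that by auto
    let ?xi = "th * exp (us s / N s)"
    have st: "steady beta mu tau gm gp th (N s) (G s) ?xi"
      using steady_log_state[OF NG] by (simp add: us_def)
    have "N s * ln (?xi / th) = us s" using NG th by simp
    moreover have "l s = - of_real (G s) - of_real (G s * hs s) * exp (- l s * of_real tau)"
    proof -
      have "l s * of_real tau = (- of_real (G s) - of_real (G s * hs s) * exp (- l s * of_real tau)) * of_real tau"
        using lr[OF that(1)] by (simp add: p_def algebra_simps)
      then show ?thesis using tau by simp
    qed
    ultimately have "char_root beta mu tau gm gp th (N s) (G s) ?xi (l s)"
      unfolding char_root_iff[OF NG(1) st] hs_def by simp
    then show ?thesis using st char_root_cnj unfolding char_root_at_def by blast
  qed
  have r0: "char_root_at beta mu tau gm gp th (N s0) (G s0) (\<i> * of_real om)"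
     "char_root_at beta mu tau gm gp th (N s0) (G s0) (- \<i> * of_real om)"
    using root[of s0] d e l0 by auto
  {
    assume "E > 0"
    then have E: "E / (h * S) > 0" using h1 S by simp
    obtain a where a: "a > 0" "\<And>x. x > 0 \<Longrightarrow> x < a \<Longrightarrow> gap j (p s0) (hs s0) < gap j (p (s0 + x)) (hs (s0 + x))"
      using DERIV_pos_inc_right[OF dgap E] by blast
    obtain b where b: "b > 0" "\<And>x. x > 0 \<Longrightarrow> x < b \<Longrightarrow> gap j (p (s0 - x)) (hs (s0 - x)) < gap j (p s0) (hs s0)"
      using DERIV_pos_inc_left[OF dgap E] by blast
    define m where "m = Min {d, e, a, b}"
    have m: "m > 0" "m \<le> d" "m \<le> e" "m \<le> a" "m \<le> b" using d e a b by (auto simp: m_def)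
    have "Re (l s) < 0" if "s0 - m < s" "s < s0" for s
      using ls[of s] b(2)[of "s0 - s"] that m unfolding gp0 by (simp add: sgn_if split: if_splits)
    moreover have "Re (l s) > 0" if "s0 < s" "s < s0 + m" for s
      using ls[of s] a(2)[of "s - s0"] that m unfolding gp0 by (simp add: sgn_if split: if_splits)
    moreover have "char_root_at beta mu tau gm gp th (N s) (G s) (l s)" if "\<bar>s - s0\<bar> < m" for s
      using root[of s] that m by auto
    ultimately have "hopf_LR (\<lambda>s. char_root_at beta mu tau gm gp th (N s) (G s)) s0 om"
      unfolding hopf_LR_def using om0 r0 m(1) lc l0
      by (intro conjI exI[where P = "\<lambda>d. d > 0 \<and> _ d", OF conjI[OF m(1)]] exI[of _ l]) auto
    then show "\<exists>om. om * tau \<in> branch j \<and>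
        hopf_LR (\<lambda>s. char_root_at beta mu tau gm gp th (N s) (G s)) s0 om" using om by blast
  next
    assume "E < 0"
    then have E: "E / (h * S) < 0" using h1 S by (simp add: divide_less_0_iff)
    obtain a where a: "a > 0" "\<And>x. x > 0 \<Longrightarrow> x < a \<Longrightarrow> gap j (p s0) (hs s0) > gap j (p (s0 + x)) (hs (s0 + x))"
      using DERIV_neg_dec_right[OF dgap E] by blast
    obtain b where b: "b > 0" "\<And>x. x > 0 \<Longrightarrow> x < b \<Longrightarrow> gap j (p (s0 - x)) (hs (s0 - x)) > gap j (p s0) (hs s0)"
      using DERIV_neg_dec_left[OF dgap E] by blast
    define m where "m = Min {d, e, a, b}"
    have m: "m > 0" "m \<le> d" "m \<le> e" "m \<le> a" "m \<le> b" using d e a b by (auto simp: m_def)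
    have "Re (l s) > 0" if "s0 - m < s" "s < s0" for s
      using ls[of s] b(2)[of "s0 - s"] that m unfolding gp0 by (simp add: sgn_if split: if_splits)
    moreover have "Re (l s) < 0" if "s0 < s" "s < s0 + m" for s
      using ls[of s] a(2)[of "s - s0"] that m unfolding gp0 by (simp add: sgn_if split: if_splits)
    moreover have "char_root_at beta mu tau gm gp th (N s) (G s) (l s)" if "\<bar>s - s0\<bar> < m" for s
      using root[of s] that m by auto
    ultimately have "hopf_RL (\<lambda>s. char_root_at beta mu tau gm gp th (N s) (G s)) s0 om"
      unfolding hopf_RL_def using om0 r0 m(1) lc l0
      by (intro conjI exI[where P = "\<lambda>d. d > 0 \<and> _ d", OF conjI[OF m(1)]] exI[of _ l]) auto
    then show "\<exists>om. om * tau \<in> branch j \<and>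
        hopf_RL (\<lambda>s. char_root_at beta mu tau gm gp th (N s) (G s)) s0 om" using om by blast
  }
qed

lemma stable_small_elasticity:
  assumes n: "n > 0" and st: "steady beta mu tau gm gp th n gam xi"
    and e: "\<bar>xi * deriv (hill gm gp th n) xi / hill gm gp th n xi\<bar> < 1"
  shows "asym_stable beta mu tau gm gp th n gam xi"
proof (rule stable_if_sens[OF n st])
  have xi: "xi > 0" using st by (simp add: steady_def)
  have "hill gm gp th n xi > 0" using gp by (simp add: hill_eq[OF xi])
  then have "xi * deriv (hill gm gp th n) xi / hill gm gp th n xi = - (n * sens r (n * ln (xi / th)))"
    unfolding deriv_hill[OF xi] using xi by (simp add: field_simps)
  then show "n * sens r (n * ln (xi / th)) < 1" using e by simp
qed

lemma stable_small_ratio: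
  assumes n: "n > 0" and st: "steady beta mu tau gm gp th n gam xi"
    and c: "n \<le> 1 \<or> (n > 1 \<and> gm / gp < (1 + 2 / (n - 1))\<^sup>2)"
  shows "asym_stable beta mu tau gm gp th n gam xi"
proof (rule stable_if_sens[OF n st])
  let ?s = "sens r (n * ln (xi / th))"
  show "n * ?s < 1" using c
  proof
    assume "n \<le> 1"
    then have "n * ?s \<le> 1 * ?s" using sens_pos[OF r_gt_1] by (intro mult_right_mono) (auto intro: less_imp_le)
    then show ?thesis using sens_less_exp(3)[OF r_gt_1, of "n * ln (xi / th)"] by linarith
  next
    assume c: "n > 1 \<and> gm / gp < (1 + 2 / (n - 1))\<^sup>2"
    then have "sqrt r < 1 + 2 / (n - 1)"
      using real_sqrt_less_mono[of r "(1 + 2 / (n - 1))\<^sup>2"] by (simp add: r_def[symmetric])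
    then have "n * (sqrt r - 1) < sqrt r + 1" using c by (simp add: field_simps)
    moreover have "sqrt r + 1 > 0" using r_gt_1 by (simp add: add_pos_pos)
    ultimately have "n * ((sqrt r - 1) / (sqrt r + 1)) < 1" by (simp add: divide_simps)
    moreover have "n * ?s \<le> n * ((sqrt r - 1) / (sqrt r + 1))" using n sens_le_max[OF r_gt_1] by (intro mult_left_mono) auto
    ultimately show ?thesis by linarith
  qed
qed

lemma stable_far_from_threshold:
  assumes n: "n > 0" and st: "steady beta mu tau gm gp th n gam xi"
    and far: "n * (r - 1) \<le> exp (n * \<bar>ln (xi / th)\<bar>)"
  shows "asym_stable beta mu tau gm gp th n gam xi"
proof (rule stable_if_sens[OF n st])
  let ?u = "n * ln (xi / th)"
  have abs: "\<bar>?u\<bar> = n * \<bar>ln (xi / th)\<bar>" using n by (simp add: abs_mult)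
  have "sens r u < (r - 1) * exp (- \<bar>u\<bar>)" for u
    using sens_less_exp(1,2)[OF r_gt_1, of u] by (cases "u \<ge> 0") simp_all
  then have "sens r ?u < (r - 1) * exp (- (n * \<bar>ln (xi / th)\<bar>))" using abs by metis
  then have "n * sens r ?u < n * ((r - 1) * exp (- (n * \<bar>ln (xi / th)\<bar>)))" using n by simp
  also have "\<dots> \<le> 1" using far by (simp add: exp_minus field_simps)
  finally show "n * sens r ?u < 1" .
qed

lemma steady_bounds:
  assumes n: "n > 0" and st: "steady beta mu tau gm gp th n gam xi"
  shows "gam > 0" "xi > 0" "g1 / gam < xi / th" "xi / th < g1 * r / gam"
proof -
  let ?L = "log_hill r (n * ln (xi / th))"
  show g: "gam > 0" and x: "xi > 0" using st by (auto simp: steady_iff[OF n])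
  have "?L = ln (gam / g1) + ln (xi / th)" using st n by (simp add: steady_iff[OF n])
  also have "\<dots> = ln (gam / g1 * (xi / th))" using g x g1_pos th by (subst ln_mult_pos) auto
  finally have eq: "exp ?L = gam / g1 * (xi / th)" using g x g1_pos th by simp
  have "exp 0 < exp ?L" "exp ?L < exp (ln r)" using log_hill_bounds[OF r_gt_1] by auto
  then show "g1 / gam < xi / th" "xi / th < g1 * r / gam"
    using r_gt_1 g g1_pos th unfolding eq by (simp_all add: field_simps)
qed

lemma stable_extreme_state:
  assumes n: "n > 1"
  shows "\<exists>e>0. \<exists>M. \<forall>gam xi. gam > 0 \<and> steady beta mu tau gm gp th n gam xi \<and> (xi < e \<or> xi > M)
            \<longrightarrow> asym_stable beta mu tau gm gp th n gam xi"
proof -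
  define K where "K = n * (r - 1)"
  have "asym_stable beta mu tau gm gp th n gam xi"
    if st: "steady beta mu tau gm gp th n gam xi" and x: "xi < th * exp (- \<bar>ln K\<bar>) \<or> xi > th * exp \<bar>ln K\<bar>" for gam xi
  proof (rule stable_far_from_threshold[OF _ st])
    have xi: "xi / th > 0" using st th by (simp add: steady_def)
    have "\<bar>ln K\<bar> \<le> \<bar>ln (xi / th)\<bar>" using x
    proof
      assume "xi < th * exp (- \<bar>ln K\<bar>)"
      then have "xi / th < exp (- \<bar>ln K\<bar>)" using th by (simp add: field_simps)
      then have "ln (xi / th) < - \<bar>ln K\<bar>" using xi by (metis ln_exp ln_less_cancel_iff exp_gt_zero)
      then show ?thesis by linarith
    next
      assume "xi > th * exp \<bar>ln K\<bar>"
      then have "xi / th > exp \<bar>ln K\<bar>" using th by (simp add: field_simps)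
      then have "ln (xi / th) > \<bar>ln K\<bar>" using xi by (metis ln_exp ln_less_cancel_iff exp_gt_zero)
      then show ?thesis by linarith
    qed
    also have "\<dots> \<le> n * \<bar>ln (xi / th)\<bar>" using n by (intro mult_le_cancel_right1[THEN iffD2]) auto
    finally have "ln K \<le> n * \<bar>ln (xi / th)\<bar>" by linarith
    moreover have "K > 0" using n r_gt_1 by (simp add: K_def)
    ultimately have "K \<le> exp (n * \<bar>ln (xi / th)\<bar>)" by (metis exp_le_cancel_iff exp_ln)
    then show "n * (r - 1) \<le> exp (n * \<bar>ln (xi / th)\<bar>)" by (simp add: K_def)
  qed (use n in simp)
  note * = this
  show ?thesis
  proof (rule exI[of _ "th * exp (- \<bar>ln K\<bar>)"], intro conjI, goal_cases)
    case 1
    show ?case using th by simp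
  next
    case 2
    show ?case by (rule exI[of _ "th * exp \<bar>ln K\<bar>"]) (intro allI impI, elim conjE, rule *)
  qed
qed

lemma stable_extreme_gam:
  assumes n: "n > 1"
  shows "\<exists>e>0. \<exists>M. \<forall>gam xi. gam > 0 \<and> steady beta mu tau gm gp th n gam xi \<and> (gam < e \<or> gam > M)
            \<longrightarrow> asym_stable beta mu tau gm gp th n gam xi"
proof -
  obtain e M where e: "e > 0" and *: "\<And>gam xi. gam > 0 \<and> steady beta mu tau gm gp th n gam xi \<and> (xi < e \<or> xi > M)
            \<Longrightarrow> asym_stable beta mu tau gm gp th n gam xi"
    using stable_extreme_state[OF n] by blast
  define M' where "M' = \<bar>M\<bar> + 1"
  have M': "M' > 0" "M' > M" by (auto simp: M'_def)
  show ?thesis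
  proof (rule exI[of _ "g1 * th / M'"], intro conjI, goal_cases)
    case 1
    show ?case using g1_pos th M' by simp
  next
    case 2
    show ?case
    proof (rule exI[of _ "g1 * r * th / e"], intro allI impI)
      fix gam xi assume a: "gam > 0 \<and> steady beta mu tau gm gp th n gam xi \<and> (gam < g1 * th / M' \<or> gam > g1 * r * th / e)"
      then have "g1 / gam < xi / th" "xi / th < g1 * r / gam" using steady_bounds[of n gam xi] n by auto
      then have b: "g1 * th / gam < xi" "xi < g1 * r * th / gam" using th a by (auto simp: field_simps)
      have "xi < e \<or> xi > M"
      proof (cases "gam < g1 * th / M'")
        case True
        then have "M' < g1 * th / gam" using a M' by (simp add: field_simps)
        then show ?thesis using b M' by linarith
      next
        case False
        then have "g1 * r * th / gam < e" using a e by (simp add: field_simps)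
        then show ?thesis using b by linarith
      qed
      then show "asym_stable beta mu tau gm gp th n gam xi" using * a by blast
    qed
  qed
qed

lemma stable_large_n:
  assumes b: "l > 0" and n: "n > 0" "n \<ge> 2 * (r - 1) / l\<^sup>2"
    and st: "steady beta mu tau gm gp th n gam xi" and x: "\<bar>ln (xi / th)\<bar> \<ge> l"
  shows "asym_stable beta mu tau gm gp th n gam xi"
proof (rule stable_far_from_threshold[OF n(1) st])
  have "n * (r - 1) \<le> exp (n * l)" using exp_dominates_linear[OF b n] by simp
  also have "\<dots> \<le> exp (n * \<bar>ln (xi / th)\<bar>)" using x n by simp
  finally show "n * (r - 1) \<le> exp (n * \<bar>ln (xi / th)\<bar>)" .
qed

lemma stable_large_n_fixed_state:
  assumes xi: "xi > 0" "xi \<noteq> th"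
  shows "\<exists>N. \<forall>n \<ge> N. n > 0 \<longrightarrow>
     asym_stable beta mu tau gm gp th n (beta * exp (- mu * tau) * hill gm gp th n xi / xi) xi"
proof -
  have l: "\<bar>ln (xi / th)\<bar> > 0" using xi th by simp
  have "steady beta mu tau gm gp th n (beta * exp (- mu * tau) * hill gm gp th n xi / xi) xi" for n
    using xi by (simp add: steady_def)
  from stable_large_n[OF l _ _ this order.refl] show ?thesis by blast
qed

lemma stable_large_n_fixed_gam:
  assumes gam: "(0 < gam \<and> gam < g1) \<or> gam > g1 * r"
  shows "\<exists>N. \<forall>n \<ge> N. n > 0 \<longrightarrow>
     (\<forall>xi. steady beta mu tau gm gp th n gam xi \<longrightarrow> asym_stable beta mu tau gm gp th n gam xi)"
proof -
  define l where "l = (if gam < g1 then ln (g1 / gam) else - ln (g1 * r / gam))"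
  have g0: "gam > 0"
  proof -
    have "0 < g1 * r" using g1_pos r_gt_1 by simp
    then show ?thesis using gam by linarith
  qed
  have g1r: "g1 < g1 * r" using g1_pos r_gt_1 by simp
  have l: "l > 0" using gam g0 g1_pos r_gt_1 g1r unfolding l_def by (auto simp: ln_div mult_pos_pos)
  have "\<bar>ln (xi / th)\<bar> \<ge> l" if st: "steady beta mu tau gm gp th n gam xi" and n: "n > 0" for n xi
  proof -
    note b = steady_bounds[OF n st]
    have "ln (g1 / gam) < ln (xi / th)" "ln (xi / th) < ln (g1 * r / gam)"
      using b g1_pos g0 r_gt_1 th by (subst ln_less_cancel_iff; simp)+
    then show ?thesis unfolding l_def by auto
  qed
  from stable_large_n[OF l _ _ _ this] show ?thesis by blast
qed

definition "gam_of n u = g1 * exp (log_hill r u - u / n)"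

lemma gam_of_pos: "gam_of n u > 0" using g1_pos by (simp add: gam_of_def)

lemma log_state_gam_of: "n > 0 \<Longrightarrow> log_state r (1 / n) (ln (gam_of n u / g1)) = u"
  using g1_pos by (intro log_state_unique[OF r_gt_1]) (auto simp: gam_of_def)

lemma gam_of_less_iff: "n > 0 \<Longrightarrow> gam_of n u < gam_of n v \<longleftrightarrow> v < u"
  using log_state_less[OF r_gt_1, of "1 / n" u v] log_state_less[OF r_gt_1, of "1 / n" v u] g1_pos
  by (cases u v rule: linorder_cases) (auto simp: gam_of_def)

lemma steady_gam_of:
  "n > 0 \<Longrightarrow> steady beta mu tau gm gp th n gam xi \<Longrightarrow> gam = gam_of n (n * ln (xi / th))"
  using g1_pos by (simp add: steady_iff gam_of_def)

lemma isCont_gam_gap: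
  "n > 0 \<Longrightarrow> isCont (\<lambda>u. gap j (gam_of n u * tau) (n * sens r u)) u"
  unfolding gam_of_def using DERIV_isCont[OF log_hill_deriv[OF r_gt_1]] isCont_sens[OF r_gt_1]
  by (intro isCont_gap continuous_intros) auto

lemma gam_of_0: "gam_of n 0 = g1 * (r + 1) / 2"
  by (simp add: gam_of_def exp_log_hill[OF r_gt_1])

lemma exp_half_ln: "exp (ln r / 2) = sqrt r"
  using r_gt_1 by (simp add: ln_sqrt[symmetric])

lemma log_hill_half: "log_hill r (ln r / 2) = ln r / 2"
proof -
  have "sqrt r > 0" using r_gt_1 by simp
  moreover have "r = sqrt r * sqrt r" using r_gt_1 by simp
  ultimately have "(r + sqrt r) / (1 + sqrt r) = sqrt r"
    by (metis add.commute add_pos_pos distrib_left less_numeral_extra(1) mult.right_neutral nonzero_mult_div_cancel_right order_less_irrefl)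
  then have "exp (log_hill r (ln r / 2)) = exp (ln r / 2)"
    unfolding exp_log_hill[OF r_gt_1] exp_half_ln .
  then show ?thesis by simp
qed

lemma gam_of_half: "gam_of n (ln r / 2) = g1 * sqrt r / r powr (1 / (2 * n))"
  unfolding gam_of_def log_hill_half exp_diff exp_half_ln using r_gt_1 by (simp add: powr_def field_simps)

lemma middle_gap_pos:
  assumes n: "n \<ge> 1" and H1: "n * sens r 0 > 1"
    and H: "((2 * real k + 1) * pi)\<^sup>2 < (g1 * tau)\<^sup>2 * ((n * sens r 0)\<^sup>2 - 1)"
    and u: "0 \<le> u" "u \<le> ln r / 2" and j: "j \<le> k"
  shows "gap j (gam_of n u * tau) (n * sens r u) > 0"
proof (rule gap_pos_if)
  define y where "y = exp u"
  have "exp 0 \<le> y" unfolding y_def using u by simp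
  moreover have "y \<le> exp (ln r / 2)" unfolding y_def using u by simp
  ultimately have y: "1 \<le> y" "y \<le> sqrt r" by (simp_all add: exp_half_ln)
  have "sqrt r \<le> r" using r_gt_1 by (metis less_imp_le mult_left_le_imp_le power2_eq_square real_le_lsqrt self_le_power zero_less_numeral less_trans zero_less_one)
  then have yr: "y \<le> r" using y by linarith
  have "0 \<le> (y - 1) * (r - y)" using y yr by simp
  then have "(r + y) * (1 + y) \<le> y * (2 * (r + 1))" by (simp add: algebra_simps)
  then have "(r - 1) * ((r + y) * (1 + y)) \<le> (r - 1) * (y * (2 * (r + 1)))" using r_gt_1 by (intro mult_left_mono) auto
  then have "sens r 0 \<le> sens r u" using r_gt_1 y unfolding sens_def y_def[symmetric]
    by (simp add: divide_simps mult_ac)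
  then have hh: "n * sens r 0 \<le> n * sens r u" using n by (intro mult_left_mono) auto
  then show "n * sens r u > 1" using H1 by linarith
  show "gam_of n u * tau > 0" using gam_of_pos tau by simp
  have "u / n \<le> u" using n u by (simp add: divide_le_eq mult_le_cancel_left1)
  also have "u \<le> log_hill r (ln r / 2)" using u log_hill_half by simp
  also have "\<dots> \<le> log_hill r u" using log_hill_antimono[OF r_gt_1] u by simp
  finally have "g1 \<le> gam_of n u" using g1_pos by (simp add: gam_of_def)
  then have "(g1 * tau)\<^sup>2 \<le> (gam_of n u * tau)\<^sup>2" using g1_pos tau by (intro power_mono mult_right_mono) auto
  moreover have "(n * sens r 0)\<^sup>2 \<le> (n * sens r u)\<^sup>2" using hh H1 by (intro power_mono) auto
  moreover have "0 \<le> (n * sens r 0)\<^sup>2 - 1" using H1 by simp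
  ultimately have "(g1 * tau)\<^sup>2 * ((n * sens r 0)\<^sup>2 - 1) \<le> (gam_of n u * tau)\<^sup>2 * ((n * sens r u)\<^sup>2 - 1)"
    by (intro mult_mono) auto
  moreover have "((2 * real j + 1) * pi)\<^sup>2 \<le> ((2 * real k + 1) * pi)\<^sup>2"
    using j by (intro power_mono mult_right_mono) auto
  ultimately show "((2 * real j + 1) * pi)\<^sup>2 \<le> (gam_of n u * tau)\<^sup>2 * ((n * sens r u)\<^sup>2 - 1)"
    using H by linarith
qed

lemma gap_pos_char_roots:
  assumes n: "n > 0" and st: "steady beta mu tau gm gp th n gam xi"
    and g: "gap j (gam * tau) (n * sens r (n * ln (xi / th))) > 0"
  shows "\<exists>al om. al > 0 \<and> om * tau \<in> branch j \<and>
      char_root beta mu tau gm gp th n gam xi (Complex al om) \<and>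
      char_root beta mu tau gm gp th n gam xi (Complex al (- om))"
proof -
  let ?h = "n * sens r (n * ln (xi / th))"
  have "gam * tau > 0" using steady_bounds(1)[OF n st] tau by simp
  from gap_pos_root[OF this g] obtain w where w: "w \<in> branch j" "growth w > gam * tau"
    "modulus w = ?h * (gam * tau) * exp (gam * tau)" by blast
  define z where "z = Complex ((growth w - gam * tau) / tau) (w / tau)"
  have zt: "z * of_real tau = Complex (growth w - gam * tau) w" using tau by (simp add: z_def complex_eq_iff)
  have "z * of_real tau = (- of_real gam - of_real (gam * ?h) * exp (- z * of_real tau)) * of_real tau"
    using branch_root[OF w(1,3)] unfolding zt[symmetric] by (simp add: algebra_simps)
  then have "z = - of_real gam - of_real (gam * ?h) * exp (- z * of_real tau)" using tau by simp
  then have c: "char_root beta mu tau gm gp th n gam xi z" unfolding char_root_iff[OF n st] .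
  have "cnj z = Complex ((growth w - gam * tau) / tau) (- (w / tau))" by (simp add: z_def complex_eq_iff)
  then show ?thesis using c char_root_cnj[OF c] w tau
    by (intro exI[of _ "(growth w - gam * tau) / tau"] exI[of _ "w / tau"]) (simp add: z_def)
qed

lemma hopf_first_family:
  assumes n: "n \<ge> 1" and g: "gap j (gam_of n (ln r / 2) * tau) (n * sens r (ln r / 2)) > 0"
  shows "\<exists>gam om. 0 < gam \<and> gam < gam_of n (ln r / 2) \<and> om * tau \<in> branch j \<and>
      hopf_LR (\<lambda>s. char_root_at beta mu tau gm gp th n s) gam om"
proof -
  let ?f = "\<lambda>u. gap j (gam_of n u * tau) (n * sens r u)"
  define b where "b = \<bar>ln (n * (r - 1))\<bar> + ln r / 2"
  have K: "n * (r - 1) > 0" using n r_gt_1 by simp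
  have l0: "ln r > 0" using r_gt_1 by simp
  have "n * sens r b < n * ((r - 1) * exp (- b))" using sens_less_exp(2)[OF r_gt_1] n by simp
  also have "\<dots> = exp (ln (n * (r - 1)) - b)" unfolding exp_diff using K by (simp add: exp_minus field_simps)
  also have "\<dots> \<le> exp 0" unfolding exp_le_cancel_iff b_def using l0 by linarith
  finally have "?f b < 0" using gap_pos_D[of j "gam_of n b * tau" "n * sens r b"] by force
  then have "\<exists>u\<ge>ln r / 2. u \<le> b \<and> ?f u = 0"
    using g n isCont_gam_gap[of n _ j] by (intro IVT2) (auto simp: b_def)
  then obtain u where u: "u \<ge> ln r / 2" "?f u = 0" by blast
  have ul: "u > ln r / 2" using u g by (cases "u = ln r / 2") auto
  let ?g = "gam_of n u"
  have n0: "n > 0" using n by simp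
  have h1: "n * sens r u > 1" using gap_pos_D[of j "?g * tau" "n * sens r u"] u by simp
  have "exp (ln r / 2) < exp u" using ul by simp
  then have "sqrt r < exp u" by (simp add: exp_half_ln)
  then have "r < (exp u)\<^sup>2" using r_gt_1 by (metis less_imp_le real_less_lsqrt real_sqrt_less_iff linorder_not_less real_le_lsqrt exp_ge_zero real_sqrt_abs abs_of_nonneg)
  then have m: "sens_slope r u < 0" unfolding sens_slope_def using r_gt_1
    by (intro divide_neg_pos mult_pos_pos add_pos_pos) auto
  have k: "sens r u > 0" by (rule sens_pos[OF r_gt_1])
  define h' where "h' = 0 * sens r u + n * (sens r u * sens_slope r u * ((u * 0 / n\<^sup>2 - 1 / ?g) / (sens r u + 1 / n)))"
  have h': "h' > 0"
  proof -
    have "(u * 0 / n\<^sup>2 - 1 / ?g) / (sens r u + 1 / n) < 0"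
      using gam_of_pos k n0 by (intro divide_neg_pos add_pos_pos) auto
    moreover have "sens r u * sens_slope r u < 0" using k m by (rule mult_pos_neg)
    ultimately have "0 < sens r u * sens_slope r u * ((u * 0 / n\<^sup>2 - 1 / ?g) / (sens r u + 1 / n))"
      by (rule mult_neg_neg[rotated])
    then have "0 < n * (sens r u * sens_slope r u * ((u * 0 / n\<^sup>2 - 1 / ?g) / (sens r u + 1 / n)))"
      by (rule mult_pos_pos[OF n0])
    then show ?thesis unfolding h'_def by (simp only: mult_zero_left add_0)
  qed
  have "1 * tau * ((n * sens r u)\<^sup>2 - 1) * (n * sens r u) + ?g * tau * (n * sens r u)\<^sup>2 * h' + h' > 0"
    using h' h1 tau gam_of_pos[of n u] k n0 by (intro add_pos_pos mult_pos_pos) auto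
  then have "\<exists>om. om * tau \<in> branch j \<and> hopf_LR (\<lambda>s. char_root_at beta mu tau gm gp th n s) ?g om"
    using hopf_crossing(1)[OF DERIV_const[of n "at ?g"] DERIV_ident n0 gam_of_pos, of j] u(2) log_state_gam_of[OF n0, of u]
    unfolding h'_def by simp
  moreover have "?g < gam_of n (ln r / 2)" using gam_of_less_iff[OF n0] ul by blast
  ultimately show ?thesis using gam_of_pos by blast
qed

lemma hopf_second_family:
  assumes n: "n \<ge> 1" and H1: "n * sens r 0 > 1"
    and H: "((2 * real k + 1) * pi)\<^sup>2 < (g1 * tau)\<^sup>2 * ((n * sens r 0)\<^sup>2 - 1)" and jk: "j \<le> k"
  shows "\<exists>gam om. gam > gam_of n 0 \<and> om * tau \<in> branch j \<and>
      hopf_RL (\<lambda>s. char_root_at beta mu tau gm gp th n s) gam om"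
proof -
  let ?f = "\<lambda>u. gap j (gam_of n u * tau) (n * sens r u)"
  have n0: "n > 0" using n by simp
  have l0: "ln r > 0" using r_gt_1 by simp
  have f0: "?f 0 > 0" using middle_gap_pos[OF n H1 H _ _ jk, of 0] l0 by simp
  define b where "b = - \<bar>ln (n * (r - 1))\<bar>"
  have K: "n * (r - 1) > 0" using n r_gt_1 by simp
  have "n * sens r b < n * ((r - 1) * exp b)" using sens_less_exp(1)[OF r_gt_1] n by simp
  also have "\<dots> = exp (ln (n * (r - 1)) + b)" unfolding exp_add using K by simp
  also have "\<dots> \<le> exp 0" unfolding exp_le_cancel_iff b_def by linarith
  finally have "?f b < 0" using gap_pos_D[of j "gam_of n b * tau" "n * sens r b"] by force
  then have "\<exists>u\<ge>b. u \<le> 0 \<and> ?f u = 0"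
    using f0 n isCont_gam_gap[of n _ j] by (intro IVT) (auto simp: b_def)
  then obtain u where u: "u \<le> 0" "?f u = 0" by blast
  have ul: "u < 0" using u f0 by (cases "u = 0") auto
  define g where "g = gam_of n u"
  have g: "g > 0" by (simp add: g_def gam_of_pos)
  have gl: "gam_of n 0 < g" using gam_of_less_iff[OF n0] ul g_def by blast
  define y where "y = exp u"
  have y: "0 < y" "y < 1" using ul by (auto simp: y_def)
  define h where "h = n * sens r u"
  have h_eq: "h = n * (r - 1) * y / ((r + y) * (1 + y))" by (simp add: h_def sens_def y_def)
  have H_eq: "n * sens r 0 = n * (r - 1) / (2 * (r + 1))" by (simp add: sens_def)
  have h1: "h > 1" using gap_pos_D[of j "g * tau" h] u by (simp add: g_def h_def)
  have "(g * tau)\<^sup>2 * (h\<^sup>2 - 1) < ((2 * real j + 1) * pi)\<^sup>2"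
    using u g tau by (intro gap_zero_imp) (auto simp: g_def h_def)
  also have "((2 * real j + 1) * pi)\<^sup>2 \<le> ((2 * real k + 1) * pi)\<^sup>2"
    using jk by (intro power_mono mult_right_mono) auto
  also note H
  finally have "(g * tau)\<^sup>2 * (h\<^sup>2 - 1) < (g1 * tau)\<^sup>2 * ((n * sens r 0)\<^sup>2 - 1)" .
  moreover have "(g1 * ((r + 1) / 2) * tau)\<^sup>2 * (h\<^sup>2 - 1) \<le> (g * tau)\<^sup>2 * (h\<^sup>2 - 1)"
    using gl h1 tau g1_pos r_gt_1 unfolding gam_of_0 by (intro mult_right_mono power_mono) auto
  moreover have "(g1 * ((r + 1) / 2) * tau)\<^sup>2 * (h\<^sup>2 - 1) = (g1 * tau)\<^sup>2 * ((h\<^sup>2 - 1) * ((r + 1) / 2)\<^sup>2)"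
    by (simp add: power2_eq_square)
  ultimately have "(g1 * tau)\<^sup>2 * ((h\<^sup>2 - 1) * ((r + 1) / 2)\<^sup>2) < (g1 * tau)\<^sup>2 * ((n * sens r 0)\<^sup>2 - 1)"
    by linarith
  then have "(h\<^sup>2 - 1) * ((r + 1) / 2)\<^sup>2 < (n * sens r 0)\<^sup>2 - 1"
    using g1_pos tau by (simp add: mult_less_cancel_left)
  then have key: "(h\<^sup>2 - 1) * (1 + h) \<le> h\<^sup>2 * (h + n * ((1 - y) / (1 + y)))"
    using transversality_bound[OF n0 r_gt_1 y] h1 unfolding h_eq H_eq by blast
  define m where "m = sens_slope r u"
  have nm: "n * m = h + n * ((1 - y) / (1 + y))"
    unfolding m_def sens_slope_def y_def[symmetric] h_eq using r_gt_1 y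
    by (simp add: divide_simps) (simp add: algebra_simps power2_eq_square)
  have nm0: "n * m > 0" unfolding nm using h1 n0 y by (intro add_pos_pos mult_pos_pos) auto
  define h' where "h' = 0 * sens r u + n * (sens r u * sens_slope r u * ((u * 0 / n\<^sup>2 - 1 / g) / (sens r u + 1 / n)))"
  have h'_eq: "h' = - (h * (n * m) / (g * (1 + h)))"
  proof -
    have "sens r u + 1 / n = (1 + h) / n" using n0 by (simp add: h_def field_simps)
    then show ?thesis unfolding h'_def using n0 g h1 by (simp add: m_def h_def field_simps)
  qed
  have h'neg: "h' < 0" unfolding h'_eq using h1 g nm0 by simp
  have "1 * tau * (h\<^sup>2 - 1) * h + g * tau * h\<^sup>2 * h' = tau * h * ((h\<^sup>2 - 1) - h\<^sup>2 * (n * m) / (1 + h))"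
  proof -
    have "1 + h \<noteq> 0" using h1 by simp
    then show ?thesis unfolding h'_eq using g by (simp add: divide_simps) (simp add: algebra_simps power2_eq_square)
  qed
  also have "\<dots> \<le> 0"
  proof -
    have "h\<^sup>2 - 1 \<le> h\<^sup>2 * (n * m) / (1 + h)" using key h1 unfolding nm by (simp add: le_divide_eq)
    then show ?thesis using tau h1 by (intro mult_nonneg_nonpos) auto
  qed
  finally have "1 * tau * (h\<^sup>2 - 1) * h + g * tau * h\<^sup>2 * h' + h' < 0" using h'neg by linarith
  then have "\<exists>om. om * tau \<in> branch j \<and> hopf_RL (\<lambda>s. char_root_at beta mu tau gm gp th n s) g om"
    using hopf_crossing(2)[OF DERIV_const[of n "at g"] DERIV_ident n0 g, of j] u(2) log_state_gam_of[OF n0, of u]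
    unfolding g_def[symmetric] h_def h'_def by simp
  then show ?thesis using gl by blast
qed

lemma hopf_in_exponent:
  assumes gam: "g1 < gam" "gam < g1 * r"
  shows "\<exists>n om. n > 0 \<and> om * tau \<in> branch j \<and>
      hopf_LR (\<lambda>m. char_root_at beta mu tau gm gp th m gam) n om"
proof -
  define C c where "C = gam / g1" and "c = ln C"
  have C: "1 < C" "C < r" using gam g1_pos by (auto simp: C_def field_simps)
  have g0: "gam > 0" using gam g1_pos by linarith
  have c: "0 < c" "c < ln r" using C r_gt_1 by (auto simp: c_def)
  define u where "u n = log_state r (1 / n) c" for n
  have ueq: "log_hill r (u n) - u n / n = c" if "n > 0" for n
    using log_state_eq[OF r_gt_1, of "1 / n" c] that by (simp add: u_def)
  have du: "isCont u n" if "n > 0" for n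
    using DERIV_isCont[OF log_state_deriv[OF DERIV_ident[of "at n"] DERIV_const[of gam "at n"] that g0]]
    by (simp add: u_def[abs_def] c_def C_def)
  define us where "us = ln ((r - C) / (C - 1))"
  have Lus: "log_hill r us = c"
  proof -
    have "exp us = (r - C) / (C - 1)" using C by (simp add: us_def)
    moreover have "1 + (r - C) / (C - 1) > 0" using C by (intro add_pos_pos divide_pos_pos) auto
    ultimately have "exp (log_hill r us) = C"
      unfolding exp_log_hill[OF r_gt_1] using C by (simp add: divide_eq_eq) (simp add: field_simps)
    then show ?thesis unfolding c_def by (metis ln_exp)
  qed
  have ub: "\<bar>u n\<bar> \<le> \<bar>us\<bar>" if n: "n > 0" for n
  proof (rule ccontr)
    assume a: "\<not> \<bar>u n\<bar> \<le> \<bar>us\<bar>"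
    show False
    proof (cases "u n > 0")
      case True
      then have "log_hill r (u n) \<le> log_hill r us" using a by (intro log_hill_antimono[OF r_gt_1]) auto
      moreover have "u n / n > 0" using True n by simp
      ultimately show False using ueq[OF n] Lus by linarith
    next
      case False
      then have "u n < 0" using a by auto
      then have "log_hill r (u n) \<ge> log_hill r us" "u n / n < 0"
        using a n by (auto intro!: log_hill_antimono[OF r_gt_1] divide_neg_pos)
      then show False using ueq[OF n] Lus by linarith
    qed
  qed
  define k0 where "k0 = (r - 1) * exp (- \<bar>us\<bar>) / ((r + exp \<bar>us\<bar>) * (1 + exp \<bar>us\<bar>))"
  have k0: "k0 > 0" unfolding k0_def using r_gt_1 by (intro divide_pos_pos mult_pos_pos add_pos_pos) auto
  have kb: "k0 \<le> sens r (u n)" if "n > 0" for n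
  proof -
    have "- \<bar>us\<bar> \<le> u n" "u n \<le> \<bar>us\<bar>" using ub[OF that] by linarith+
    then show ?thesis unfolding k0_def sens_def using r_gt_1
      by (intro frac_le mult_mono mult_pos_pos add_pos_pos add_left_mono mult_nonneg_nonneg) auto
  qed
  define p where "p = gam * tau"
  have p: "p > 0" using g0 tau by (simp add: p_def)
  define x where "x = (2 * real j + 1) * pi / p"
  have x: "x > 0" unfolding x_def using p by (intro divide_pos_pos mult_pos_pos) auto
  define b where "b = 1 + (1 + x) / k0"
  have b: "b > 1" using x k0 by (simp add: b_def)
  let ?f = "\<lambda>n. gap j p (n * sens r (u n))"
  have "?f 1 < 0" using gap_pos_D[of j p "1 * sens r (u 1)"] sens_less_exp(3)[OF r_gt_1, of "u 1"] by force
  moreover have "?f b > 0"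
  proof (rule gap_pos_if[OF _ p])
    have "1 + x \<le> b * k0" using k0 by (simp add: b_def field_simps)
    also have "\<dots> \<le> b * sens r (u b)" using b kb[of b] by (intro mult_left_mono) auto
    finally have h: "1 + x \<le> b * sens r (u b)" .
    then show "b * sens r (u b) > 1" using x by linarith
    have "(1 + x)\<^sup>2 \<le> (b * sens r (u b))\<^sup>2" using h x by (intro power_mono) auto
    moreover have "x\<^sup>2 + 1 \<le> (1 + x)\<^sup>2" using x by (simp add: power2_eq_square algebra_simps)
    ultimately have "x\<^sup>2 \<le> (b * sens r (u b))\<^sup>2 - 1" by linarith
    then have "p\<^sup>2 * x\<^sup>2 \<le> p\<^sup>2 * ((b * sens r (u b))\<^sup>2 - 1)" by (intro mult_left_mono) auto
    moreover have "p\<^sup>2 * x\<^sup>2 = ((2 * real j + 1) * pi)\<^sup>2" using p by (simp add: x_def power_divide)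
    ultimately show "((2 * real j + 1) * pi)\<^sup>2 \<le> p\<^sup>2 * ((b * sens r (u b))\<^sup>2 - 1)" by simp
  qed
  moreover have "isCont ?f n" if "n \<ge> 1" for n
    using du[of n] that by (intro isCont_gap continuous_intros isCont_o2[OF _ isCont_sens[OF r_gt_1]]) auto
  ultimately have "\<exists>n\<ge>1. n \<le> b \<and> ?f n = 0" using b by (intro IVT) auto
  then obtain n where n: "n \<ge> 1" "?f n = 0" by blast
  have n0: "n > 0" using n by simp
  define k m h where "k = sens r (u n)" and "m = sens_slope r (u n)" and "h = n * k"
  have k: "k > 0" unfolding k_def by (rule sens_pos[OF r_gt_1])
  have h1: "h > 1" using gap_pos_D[of j p h] n by (simp add: h_def k_def)
  define h' where "h' = 1 * k + n * (k * m * ((u n * 1 / n\<^sup>2 - 0 / gam) / (k + 1 / n)))"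
  have "h' = k / (1 + h) * (1 + h + m * u n)"
  proof -
    have e: "k + 1 / n = (1 + h) / n" using n0 by (simp add: h_def field_simps)
    have "1 + h \<noteq> 0" using h1 by simp
    then show ?thesis unfolding h'_def e using n0 by (simp add: divide_simps power2_eq_square) (simp add: algebra_simps)
  qed
  moreover have "1 + h + m * u n > 0"
    unfolding h_def m_def k_def using sens_slope_bound[OF r_gt_1 n0 ueq[OF n0] c] .
  ultimately have h': "h' > 0" using k h1 by simp
  have "0 * tau * (h\<^sup>2 - 1) * h + gam * tau * h\<^sup>2 * h' + h' > 0"
    using h' h1 g0 tau by (simp add: add_pos_pos)
  then have "\<exists>om. om * tau \<in> branch j \<and> hopf_LR (\<lambda>m. char_root_at beta mu tau gm gp th m gam) n om"
    using hopf_crossing(1)[OF DERIV_ident[of "at n"] DERIV_const[of gam "at n"] n0 g0, of j] n(2)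
    unfolding h'_def h_def k_def m_def u_def c_def C_def p_def by simp
  then show ?thesis using n0 by blast
qed

lemma middle_hypothesis:
  assumes "n > 2 * (r + 1) / (r - 1) * sqrt (1 + ((2 * real k + 1) * pi / (g1 * tau))\<^sup>2)"
  shows "n * sens r 0 > 1" "((2 * real k + 1) * pi)\<^sup>2 < (g1 * tau)\<^sup>2 * ((n * sens r 0)\<^sup>2 - 1)"
proof -
  define x where "x = (2 * real k + 1) * pi / (g1 * tau)"
  have gt: "g1 * tau > 0" using g1_pos tau by simp
  have "sqrt (1 + x\<^sup>2) < n * ((r - 1) / (2 * (r + 1)))"
    using assms r_gt_1 unfolding x_def[symmetric] by (simp add: field_simps)
  then have H: "sqrt (1 + x\<^sup>2) < n * sens r 0" by (simp add: sens_def mult.commute)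
  moreover have "1 \<le> sqrt (1 + x\<^sup>2)" by simp
  ultimately show "n * sens r 0 > 1" by linarith
  have "(sqrt (1 + x\<^sup>2))\<^sup>2 < (n * sens r 0)\<^sup>2" using H by (intro power_strict_mono) auto
  then have "x\<^sup>2 < (n * sens r 0)\<^sup>2 - 1" by (simp add: add_nonneg_nonneg)
  then have "(g1 * tau)\<^sup>2 * x\<^sup>2 < (g1 * tau)\<^sup>2 * ((n * sens r 0)\<^sup>2 - 1)"
    using gt by (intro mult_strict_left_mono) auto
  moreover have "(g1 * tau)\<^sup>2 * x\<^sup>2 = ((2 * real k + 1) * pi)\<^sup>2"
    using gt g1_pos tau by (simp add: x_def power_divide)
  ultimately show "((2 * real k + 1) * pi)\<^sup>2 < (g1 * tau)\<^sup>2 * ((n * sens r 0)\<^sup>2 - 1)" by simp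
qed

lemma middle_state_range:
  assumes n: "n > 0" and st: "steady beta mu tau gm gp th n gam xi"
    and c: "(th \<le> xi \<and> xi \<le> th * r powr (1 / (2 * n))) \<or>
            (gam_of n (ln r / 2) \<le> gam \<and> gam \<le> gam_of n 0)"
  shows "0 \<le> n * ln (xi / th)" "n * ln (xi / th) \<le> ln r / 2"
proof -
  have "0 \<le> n * ln (xi / th) \<and> n * ln (xi / th) \<le> ln r / 2"
    using c
  proof
    assume c: "th \<le> xi \<and> xi \<le> th * r powr (1 / (2 * n))"
    have rp: "r powr (1 / (2 * n)) = exp (ln r / 2 / n)"
      using r_gt_1 by (simp add: powr_def)
    have x: "1 \<le> xi / th" "xi / th \<le> exp (ln r / 2 / n)" using c th unfolding rp by (auto simp: field_simps)
    have "0 \<le> ln (xi / th)" using x(1) by simp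
    moreover have "ln (xi / th) \<le> ln (exp (ln r / 2 / n))" using x by (intro ln_mono) auto
    ultimately show ?thesis using n by (simp add: field_simps)
  next
    assume c: "gam_of n (ln r / 2) \<le> gam \<and> gam \<le> gam_of n 0"
    then show ?thesis using gam_of_less_iff[OF n] steady_gam_of[OF n st] by (metis not_less)
  qed
  then show "0 \<le> n * ln (xi / th)" "n * ln (xi / th) \<le> ln r / 2" by auto
qed

end

theorem theorem5p3:
  fixes beta mu a vp gm gp th tau gam1 gam2 :: real
  assumes pos: "beta > 0" "mu > 0" "a > 0" "vp > 0" "gm > 0" "gp > 0" "th > 0"
    and decr: "gm > gp"
    and tau_def: "tau = a / vp"
    and gam1_def: "gam1 = beta * exp (- mu * tau) * gp / th"
    and gam2_def: "gam2 = beta * exp (- mu * tau) * gm / th"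
  shows
  \<comment> \<open>(1)\<close>
  "(\<forall>n gam xi. n > 0 \<and> gam > 0 \<and> steady beta mu tau gm gp th n gam xi \<and>
       \<bar>xi * deriv (hill gm gp th n) xi / hill gm gp th n xi\<bar> < 1
     \<longrightarrow> asym_stable beta mu tau gm gp th n gam xi)
  \<comment> \<open>(2)\<close>
   \<and> (\<forall>n gam xi. n > 0 \<and> gam > 0 \<and> steady beta mu tau gm gp th n gam xi \<and>
       (n \<le> 1 \<or> (n > 1 \<and> gm / gp < (1 + 2 / (n - 1))\<^sup>2))
     \<longrightarrow> asym_stable beta mu tau gm gp th n gam xi)
  \<comment> \<open>(3)\<close>
   \<and> (\<forall>n > 1.
        (\<exists>e>0. \<exists>M. \<forall>gam xi. gam > 0 \<and> steady beta mu tau gm gp th n gam xi \<and> (xi < e \<or> xi > M)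
            \<longrightarrow> asym_stable beta mu tau gm gp th n gam xi)
      \<and> (\<exists>e>0. \<exists>M. \<forall>gam xi. gam > 0 \<and> steady beta mu tau gm gp th n gam xi \<and> (gam < e \<or> gam > M)
            \<longrightarrow> asym_stable beta mu tau gm gp th n gam xi))
  \<comment> \<open>(4)\<close>
   \<and> (\<forall>xi. xi > 0 \<and> xi \<noteq> th \<longrightarrow>
        (\<exists>N. \<forall>n \<ge> N. n > 0 \<longrightarrow>
           asym_stable beta mu tau gm gp th n (beta * exp (- mu * tau) * hill gm gp th n xi / xi) xi))
   \<and> (\<forall>gam. (0 < gam \<and> gam < gam1) \<or> gam > gam2 \<longrightarrow>
        (\<exists>N. \<forall>n \<ge> N. n > 0 \<longrightarrow>
           (\<forall>xi. steady beta mu tau gm gp th n gam xi \<longrightarrow> asym_stable beta mu tau gm gp th n gam xi)))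
  \<comment> \<open>(5)\<close>
   \<and> (\<forall>n (k::nat). n \<ge> 2 \<and>
        n > 2 * ((gm / gp) + 1) / ((gm / gp) - 1) *
            sqrt (1 + (pi * th * (2 * real k + 1) / (beta * tau * exp (- mu * tau) * min gm gp))\<^sup>2)
      \<longrightarrow>
        \<comment> \<open>(a)\<close>
        (\<forall>j \<le> k.
           (\<exists>gamA om. 0 < gamA \<and> gamA < sqrt (gam1 * gam2) / (gm / gp) powr (1 / (2 * n)) \<and>
               pi / 2 + 2 * real j * pi < om * tau \<and> om * tau < pi + 2 * real j * pi \<and>
               hopf_LR (\<lambda>g l. char_root_at beta mu tau gm gp th n g l) gamA om)
         \<and> (\<exists>gamB om. gamB > (gam1 + gam2) / 2 \<and>
               pi / 2 + 2 * real j * pi < om * tau \<and> om * tau < pi + 2 * real j * pi \<and>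
               hopf_RL (\<lambda>g l. char_root_at beta mu tau gm gp th n g l) gamB om))
        \<comment> \<open>(b)\<close>
      \<and> (\<forall>gam xi. steady beta mu tau gm gp th n gam xi \<and>
           ((th \<le> xi \<and> xi \<le> th * (gm / gp) powr (1 / (2 * n))) \<or>
            (sqrt (gam1 * gam2) / (gm / gp) powr (1 / (2 * n)) \<le> gam \<and> gam \<le> (gam1 + gam2) / 2))
         \<longrightarrow> unstable beta mu tau gm gp th n gam xi \<and>
             (\<forall>j \<le> k. \<exists>al om. al > 0 \<and>
                 pi / 2 + 2 * real j * pi < om * tau \<and> om * tau < pi + 2 * real j * pi \<and>
                 char_root beta mu tau gm gp th n gam xi (Complex al om) \<and>
                 char_root beta mu tau gm gp th n gam xi (Complex al (- om)))))
  \<comment> \<open>(6)\<close>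
   \<and> (\<forall>gam. gam1 < gam \<and> gam < gam2 \<longrightarrow>
        (\<forall>k::nat. \<exists>n om. n > 0 \<and>
            pi / 2 + 2 * real k * pi < om * tau \<and> om * tau < pi + 2 * real k * pi \<and>
            hopf_LR (\<lambda>m l. char_root_at beta mu tau gm gp th m gam l) n om))"
proof -
  interpret hill_model beta mu tau gm gp th
    using pos decr tau_def by unfold_locales auto
  have gam1: "gam1 = g1" by (simp add: gam1_def g1_def)
  have gam2: "gam2 = g1 * r" using pos by (simp add: gam2_def g1_def r_def)
  have mid: "(gam1 + gam2) / 2 = gam_of n 0" for n
    unfolding gam1 gam2 gam_of_0 by (simp add: algebra_simps)
  have low: "sqrt (gam1 * gam2) / r powr (1 / (2 * n)) = gam_of n (ln r / 2)" for n
    unfolding gam1 gam2 gam_of_half using g1_pos by (simp add: real_sqrt_mult)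
  have x_eq: "pi * th * (2 * real k + 1) / (beta * tau * exp (- mu * tau) * min gm gp)
      = (2 * real k + 1) * pi / (g1 * tau)" for k
    using pos decr by (simp add: g1_def min_def mult_ac)
  have branch_iff: "w \<in> branch j \<longleftrightarrow> pi / 2 + 2 * real j * pi < w \<and> w < pi + 2 * real j * pi" for j w
    by (simp add: branch_def)
  show ?thesis (is "?A1 \<and> ?A2 \<and> ?A3 \<and> ?A4 \<and> ?A5 \<and> ?A6 \<and> ?A7")
  proof (intro conjI)
    show ?A1 using stable_small_elasticity by blast
    show ?A2 using stable_small_ratio by blast
    show ?A3 using stable_extreme_state stable_extreme_gam by blast
    show ?A4 using stable_large_n_fixed_state by blast
    show ?A5 unfolding gam1 gam2 using stable_large_n_fixed_gam by blast
    show ?A7 unfolding gam1 gam2 using hopf_in_exponent unfolding branch_iff by meson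
    show ?A6
      unfolding r_def[symmetric] x_eq low
    proof (intro allI impI, goal_cases)
      case (1 n k)
      then have n1: "n \<ge> 1" and n0: "n > 0"
        and N: "n > 2 * (r + 1) / (r - 1) * sqrt (1 + ((2 * real k + 1) * pi / (g1 * tau))\<^sup>2)" by auto
      note H = middle_hypothesis[OF N]
      note gap_pos = middle_gap_pos[OF n1 H]
      have l0: "ln r > 0" using r_gt_1 by simp
      have roots: "\<exists>al om. al > 0 \<and> om * tau \<in> branch j \<and>
          char_root beta mu tau gm gp th n gam xi (Complex al om) \<and>
          char_root beta mu tau gm gp th n gam xi (Complex al (- om))"
        if st: "steady beta mu tau gm gp th n gam xi"
          and c: "(th \<le> xi \<and> xi \<le> th * r powr (1 / (2 * n))) \<or>
              (gam_of n (ln r / 2) \<le> gam \<and> gam \<le> gam_of n 0)" and j: "j \<le> k" for gam xi j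
        using gap_pos_char_roots[OF n0 st] gap_pos[OF middle_state_range[OF n0 st c] j]
          steady_gam_of[OF n0 st] by simp
      show ?case unfolding mid[of n]
      proof (intro conjI allI impI, goal_cases)
        case (1 j)
        then show ?case
          using hopf_first_family[OF n1 gap_pos, of j] l0 unfolding branch_iff by (auto intro: less_imp_le)
      next
        case (2 j)
        then show ?case
          using hopf_second_family[OF n1 H] unfolding branch_iff by meson
      next
        case (3 gam xi)
        then show ?case using roots[of gam xi 0] unfolding unstable_def by (metis complex.sel(1) le0)
      next
        case (4 gam xi j)
        then show ?case using roots[of gam xi j] unfolding branch_iff by meson
      qed
    qed
  qed
qed

end
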